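(* Let $X_1,\ldots,X_n$ be Banach spaces. Then $(\Sigma_{X_1,\ldots,X_n},d_\pi)$ is a complete metric space.
   Context: Banach spaces are over the same field $\mathbb{R}$ or $\mathbb{C}$. $\Sigma_{X_1,\ldots,X_n}=\{x_1\otimes\cdots\otimes x_n: x_i\in X_i\}\subset X_1\otimes\cdots\otimes X_n$ is the set of decomposable tensors (the Segre cone) in the algebraic tensor product. $\pi$ is the projective norm, $\pi(z)=\inf\{\sum_i\|x_1^i\|\cdots\|x_n^i\|: z=\sum_i x_1^i\otimes\cdots\otimes x_n^i\}$ (finite sums), and $d_\pi(w,z)=\pi(w-z)$. *)

theory Defs
  imports "HOL-Analysis.Analysis" "HOL-Algebra.Algebraic_Closure_Type" "HOL-Library.Poly_Mapping"
begin

text \<open>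
  A vector space over a field type is encoded as a carrier-based module over
  \<^term>\<open>ring_of_type_algebra\<close>, so the members of a family of spaces may have unrelated carriers
  and operations; its norm is a separate function on the underlying type. The \<^const>\<open>mult\<close> and
  \<^const>\<open>one\<close> fields of a module record play no role.
\<close>

definition normed_space :: "('k::real_normed_field, 'a) module \<Rightarrow> ('a \<Rightarrow> real) \<Rightarrow> bool" where
  "normed_space E nrm \<longleftrightarrow>
     Module.module (ring_of_type_algebra :: 'k ring) E \<and>
     (\<forall>x\<in>carrier E. 0 \<le> nrm x \<and> (nrm x = 0 \<longleftrightarrow> x = \<zero>\<^bsub>E\<^esub>)) \<and>
     (\<forall>x\<in>carrier E. \<forall>y\<in>carrier E. nrm (x \<oplus>\<^bsub>E\<^esub> y) \<le> nrm x + nrm y) \<and>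
     (\<forall>c. \<forall>x\<in>carrier E. nrm (c \<odot>\<^bsub>E\<^esub> x) = norm c * nrm x)"

text \<open>
  The locale \<^locale>\<open>Metric_space\<close> asks for symmetry and nonnegativity also off the carrier, hence the
  value 0 there.
\<close>

definition induced_dist :: "('k, 'a) module \<Rightarrow> ('a \<Rightarrow> real) \<Rightarrow> 'a \<Rightarrow> 'a \<Rightarrow> real" where
  "induced_dist E nrm x y =
     (if x \<in> carrier E \<and> y \<in> carrier E then nrm (x \<ominus>\<^bsub>E\<^esub> y) else 0)"

definition banach_space :: "('k::real_normed_field, 'a) module \<Rightarrow> ('a \<Rightarrow> real) \<Rightarrow> bool" where
  "banach_space E nrm \<longleftrightarrow>
     normed_space E nrm \<and> Metric_space.mcomplete (carrier E) (induced_dist E nrm)"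

text \<open>
  The algebraic tensor product of \<open>E 1, \<dots>, E n\<close> is the free vector space on the tuples in
  \<open>E 1 \<times> \<dots> \<times> E n\<close>, modulo the subspace that makes the class of a tuple multilinear in its entries.
\<close>

abbreviation tuples :: "nat \<Rightarrow> (nat \<Rightarrow> ('k, 'a) module) \<Rightarrow> (nat \<Rightarrow> 'a) set" where
  "tuples n E \<equiv> (\<Pi>\<^sub>E i\<in>{1..n}. carrier (E i))"

definition free_space ::
  "nat \<Rightarrow> (nat \<Rightarrow> ('k::field, 'a) module) \<Rightarrow> ('k, (nat \<Rightarrow> 'a) \<Rightarrow>\<^sub>0 'k) module" where
  "free_space n E =
     \<lparr>carrier = {p. Poly_Mapping.keys p \<subseteq> tuples n E},
      monoid.mult = undefined, one = undefined,
      ring.zero = 0, add = (+), smult = (\<lambda>c. Poly_Mapping.map ((*) c))\<rparr>"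

abbreviation basis_vec :: "(nat \<Rightarrow> 'a) \<Rightarrow> (nat \<Rightarrow> 'a) \<Rightarrow>\<^sub>0 'k::field" where
  "basis_vec x \<equiv> Poly_Mapping.single x 1"

definition multilinear_relators ::
  "nat \<Rightarrow> (nat \<Rightarrow> ('k::field, 'a) module) \<Rightarrow> ((nat \<Rightarrow> 'a) \<Rightarrow>\<^sub>0 'k) set" where
  "multilinear_relators n E =
     {basis_vec (x(i := a \<oplus>\<^bsub>E i\<^esub> b)) - basis_vec (x(i := a)) - basis_vec (x(i := b)) | x i a b.
        x \<in> tuples n E \<and> i \<in> {1..n} \<and> a \<in> carrier (E i) \<and> b \<in> carrier (E i)} \<union>
     {basis_vec (x(i := c \<odot>\<^bsub>E i\<^esub> a)) - Poly_Mapping.map ((*) c) (basis_vec (x(i := a))) | x i c a.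
        x \<in> tuples n E \<and> i \<in> {1..n} \<and> a \<in> carrier (E i)}"

definition multilinear_kernel ::
  "nat \<Rightarrow> (nat \<Rightarrow> ('k::field, 'a) module) \<Rightarrow> ((nat \<Rightarrow> 'a) \<Rightarrow>\<^sub>0 'k) set" where
  "multilinear_kernel n E =
     (\<lambda>N. submodule N (ring_of_type_algebra :: 'k ring) (free_space n E)) hull
       multilinear_relators n E"

text \<open>
  Adding the kernel after scaling a coset elementwise only matters for the scalar 0, where the
  elementwise multiple of a coset is \<open>{0}\<close> instead of the zero coset.
\<close>

definition tensor_product ::
  "nat \<Rightarrow> (nat \<Rightarrow> ('k::field, 'a) module) \<Rightarrow> ('k, ((nat \<Rightarrow> 'a) \<Rightarrow>\<^sub>0 'k) set) module" where
  "tensor_product n E =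
     (let F = free_space n E; N = multilinear_kernel n E in
      \<lparr>carrier = a_rcosets\<^bsub>F\<^esub> N,
       monoid.mult = undefined, one = undefined,
       ring.zero = N, add = (\<lambda>A B. A <+>\<^bsub>F\<^esub> B),
       smult = (\<lambda>c A. N <+>\<^bsub>F\<^esub> ((\<lambda>p. c \<odot>\<^bsub>F\<^esub> p) ` A))\<rparr>)"

definition elementary_tensor ::
  "nat \<Rightarrow> (nat \<Rightarrow> ('k::field, 'a) module) \<Rightarrow> (nat \<Rightarrow> 'a) \<Rightarrow> ((nat \<Rightarrow> 'a) \<Rightarrow>\<^sub>0 'k) set" where
  "elementary_tensor n E x = multilinear_kernel n E +>\<^bsub>free_space n E\<^esub> basis_vec x"

definition segre_cone ::
  "nat \<Rightarrow> (nat \<Rightarrow> ('k::field, 'a) module) \<Rightarrow> ((nat \<Rightarrow> 'a) \<Rightarrow>\<^sub>0 'k) set set" where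
  "segre_cone n E = elementary_tensor n E ` tuples n E"

definition projective_norm ::
  "nat \<Rightarrow> (nat \<Rightarrow> ('k::field, 'a) module) \<Rightarrow> (nat \<Rightarrow> 'a \<Rightarrow> real) \<Rightarrow>
     ((nat \<Rightarrow> 'a) \<Rightarrow>\<^sub>0 'k) set \<Rightarrow> real" where
  "projective_norm n E nrm z =
     Inf {\<Sum>j<m. \<Prod>i\<in>{1..n}. nrm i (x j i) | (m::nat) x.
            (\<forall>j<m. x j \<in> tuples n E) \<and>
            z = (\<Oplus>\<^bsub>tensor_product n E\<^esub> j\<in>{..<m}. elementary_tensor n E (x j))}"

definition projective_dist ::
  "nat \<Rightarrow> (nat \<Rightarrow> ('k::field, 'a) module) \<Rightarrow> (nat \<Rightarrow> 'a \<Rightarrow> real) \<Rightarrow>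
     ((nat \<Rightarrow> 'a) \<Rightarrow>\<^sub>0 'k) set \<Rightarrow> ((nat \<Rightarrow> 'a) \<Rightarrow>\<^sub>0 'k) set \<Rightarrow> real" where
  "projective_dist n E nrm = induced_dist (tensor_product n E) (projective_norm n E nrm)"

end

theory Submission
  imports Defs
begin

text \<open>
  If functionals \<open>\<phi> i\<close> of norm at most 1 satisfy \<open>\<Prod>i. \<phi> i (x i) \<noteq> 0\<close>, then
  \<open>x 1 \<otimes> \<dots> \<otimes> x n\<close> can be rescaled to a normal form with \<open>\<phi> i (x i) = 1\<close> for \<open>i \<noteq> 1\<close>.
  By Hahn-Banach each coordinate of the normal form is controlled by the values of tensor functionals
  \<open>\<phi> 1 \<otimes> \<dots> \<otimes> \<psi> \<otimes> \<dots> \<otimes> \<phi> n\<close>, which are contractions for the projective norm.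
  So tensors at distance 0 have equal normal forms, and for a Cauchy sequence of decomposable tensors that does not
  tend to 0 the normal forms with respect to a suitable fixed \<open>\<phi>\<close> converge in every coordinate.
  Hahn-Banach itself follows from Zorn's lemma, because a minimal sublinear functional is linear.
\<close>

section \<open>Normed spaces and norming functionals\<close>

text \<open>A decomposable tensor does not determine its coordinates: scalars move freely between
  them, so a Cauchy sequence of tensors may have coordinates that do not converge at all. Moreover
  the Segre cone is not closed under differences, so the coordinates of two tensors cannot be read
  off from the difference of the tensors. Asking for \<open>\<phi> i (x i) = 1\<close> for
  \<open>i \<noteq> 1\<close> removes exactly the freedom of scaling and collects the scalar in
  coordinate 1. This is possible only where the tensor functional does not vanish, which is why the
  zero tensor and sequences tending to 0 are treated apart. Tensor functionals are never defined on
  the quotient. They live on the free space as linear extensions that vanish on the kernel, and the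
  projective norm is likewise handled through representatives in the free space. Of the norm axioms
  for the projective norm, definiteness is established only in the form that is needed: distances
  separate the points of the cone.\<close>

locale normed =
  fixes E :: "('k::real_normed_field, 'a) module" (structure) and nrm :: "'a \<Rightarrow> real"
  assumes normed_space: "normed_space E nrm"

sublocale normed \<subseteq> module "ring_of_type_algebra :: 'k ring" E
  using normed_space by (simp add: normed_space_def)

context normed
begin

lemma smult_in [simp]: "x \<in> carrier E \<Longrightarrow> c \<odot> x \<in> carrier E"
  using smult_closed[of c x] by (simp add: ring_of_type_algebra_def)

lemma smult_add_left: "x \<in> carrier E \<Longrightarrow> (a + b) \<odot> x = a \<odot> x \<oplus> b \<odot> x"
  using smult_l_distr[of a b x] by (simp add: ring_of_type_algebra_def)

lemma smult_add_right: "x \<in> carrier E \<Longrightarrow> y \<in> carrier E \<Longrightarrow> a \<odot> (x \<oplus> y) = a \<odot> x \<oplus> a \<odot> y"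
  using smult_r_distr[of a x y] by (simp add: ring_of_type_algebra_def)

lemma smult_smult: "x \<in> carrier E \<Longrightarrow> a \<odot> (b \<odot> x) = (a * b) \<odot> x"
  using smult_assoc1[of a b x] by (simp add: ring_of_type_algebra_def)

lemma smult_1 [simp]: "x \<in> carrier E \<Longrightarrow> 1 \<odot> x = x"
  using smult_one[of x] by (simp add: ring_of_type_algebra_def)

lemma smult_0 [simp]: "x \<in> carrier E \<Longrightarrow> 0 \<odot> x = \<zero>"
  using smult_l_null[of x] by (simp add: ring_of_type_algebra_def)

lemma smult_zero [simp]: "c \<odot> \<zero> = \<zero>"
  using smult_r_null[of c] by (simp add: ring_of_type_algebra_def)

lemma smult_neg_1: "x \<in> carrier E \<Longrightarrow> (-1) \<odot> x = \<ominus> x"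
proof -
  assume x: "x \<in> carrier E"
  have "(-1) \<odot> x \<oplus> x = (-1 + 1) \<odot> x"
    using x by (simp only: smult_add_left smult_1)
  also have "\<dots> = \<zero>" using x by simp
  finally show ?thesis using x by (metis minus_equality smult_in)
qed

lemma nrm_nonneg: "x \<in> carrier E \<Longrightarrow> 0 \<le> nrm x"
  and nrm_eq_0: "x \<in> carrier E \<Longrightarrow> nrm x = 0 \<longleftrightarrow> x = \<zero>"
  and nrm_add: "x \<in> carrier E \<Longrightarrow> y \<in> carrier E \<Longrightarrow> nrm (x \<oplus> y) \<le> nrm x + nrm y"
  and nrm_smult: "x \<in> carrier E \<Longrightarrow> nrm (c \<odot> x) = norm c * nrm x"
  using normed_space by (auto simp: normed_space_def)

lemma nrm_minus [simp]: "x \<in> carrier E \<Longrightarrow> nrm (\<ominus> x) = nrm x"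
  using nrm_smult[of x "-1"] by (simp add: smult_neg_1)

lemma diff_eq_zero_iff: "x \<in> carrier E \<Longrightarrow> y \<in> carrier E \<Longrightarrow> x \<ominus> y = \<zero> \<longleftrightarrow> x = y"
  by (metis a_minus_def add.inv_closed minus_minus minus_equality r_neg)

lemma diff_zero [simp]: "x \<in> carrier E \<Longrightarrow> x \<ominus> \<zero> = x"
  using smult_neg_1[of \<zero>] by (simp add: a_minus_def)

lemma diff_add_cancel: "x \<in> carrier E \<Longrightarrow> y \<in> carrier E \<Longrightarrow> (x \<ominus> y) \<oplus> y = x"
  by (simp add: a_minus_def a_assoc l_neg)

lemma nrm_minus_commute:
  assumes "x \<in> carrier E" "y \<in> carrier E" shows "nrm (x \<ominus> y) = nrm (y \<ominus> x)"
proof -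
  have "\<ominus> (x \<ominus> y) = y \<ominus> x"
    using assms by (simp add: a_minus_def minus_add add.m_comm)
  then show ?thesis using nrm_minus[of "x \<ominus> y"] assms by simp
qed

lemma nrm_triangle: "x \<in> carrier E \<Longrightarrow> y \<in> carrier E \<Longrightarrow> nrm x \<le> nrm (x \<ominus> y) + nrm y"
  using nrm_add[of "x \<ominus> y" y] by (simp add: diff_add_cancel)

lemma nrm_reverse_triangle:
  "x \<in> carrier E \<Longrightarrow> y \<in> carrier E \<Longrightarrow> \<bar>nrm x - nrm y\<bar> \<le> nrm (x \<ominus> y)"
  using nrm_triangle[of x y] nrm_triangle[of y x] nrm_minus_commute[of x y] by simp

lemma Metric_space_induced_dist: "Metric_space (carrier E) (induced_dist E nrm)"
proof
  fix x y z
  show "0 \<le> induced_dist E nrm x y"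
    by (simp add: induced_dist_def nrm_nonneg)
  show "induced_dist E nrm x y = induced_dist E nrm y x"
    by (simp add: induced_dist_def nrm_minus_commute)
  show "induced_dist E nrm x y = 0 \<longleftrightarrow> x = y" if "x \<in> carrier E" "y \<in> carrier E"
    using that by (simp add: induced_dist_def nrm_eq_0 diff_eq_zero_iff)
  show "induced_dist E nrm x z \<le> induced_dist E nrm x y + induced_dist E nrm y z"
    if "x \<in> carrier E" "y \<in> carrier E" "z \<in> carrier E"
  proof -
    have "x \<ominus> z = ((x \<ominus> y) \<oplus> y) \<ominus> z" using that by (simp add: diff_add_cancel)
    also have "\<dots> = (x \<ominus> y) \<oplus> (y \<ominus> z)" using that by (simp add: a_minus_def a_assoc)
    finally show ?thesis
      using that nrm_add[of "x \<ominus> y" "y \<ominus> z"] by (simp add: induced_dist_def)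
  qed
qed

end

section \<open>Hahn-Banach for real and complex scalars\<close>

definition unit_functional :: "('k::real_normed_field, 'a) module \<Rightarrow> ('a \<Rightarrow> real) \<Rightarrow> ('a \<Rightarrow> 'k) \<Rightarrow> bool" where
  "unit_functional E nrm \<phi> \<longleftrightarrow>
     (\<forall>x\<in>carrier E. \<forall>y\<in>carrier E. \<phi> (x \<oplus>\<^bsub>E\<^esub> y) = \<phi> x + \<phi> y) \<and>
     (\<forall>c. \<forall>x\<in>carrier E. \<phi> (c \<odot>\<^bsub>E\<^esub> x) = c * \<phi> x) \<and>
     (\<forall>x\<in>carrier E. norm (\<phi> x) \<le> nrm x)"

text \<open>Demanding only an inequality, and only for positive scalars, keeps the check for infima
  short. The reverse inequality follows by rescaling with \<open>1/t\<close>, and the value at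
  \<zero> from the scalars 2 and \<open>1/2\<close>.\<close>

definition sublinear :: "(real, 'a) module \<Rightarrow> ('a \<Rightarrow> real) \<Rightarrow> bool" where
  "sublinear E p \<longleftrightarrow>
     (\<forall>x\<in>carrier E. \<forall>y\<in>carrier E. p (x \<oplus>\<^bsub>E\<^esub> y) \<le> p x + p y) \<and>
     (\<forall>t>0. \<forall>x\<in>carrier E. p (t \<odot>\<^bsub>E\<^esub> x) \<le> t * p x)"

locale real_normed = normed E nrm for E :: "(real, 'a) module" (structure) and nrm
begin

lemma sublinear_zero: assumes "sublinear E p" shows "p \<zero> = 0"
proof -
  have "p (2 \<odot> \<zero>) \<le> 2 * p \<zero>" "p ((1/2) \<odot> \<zero>) \<le> (1/2) * p \<zero>"
    using assms zero_closed unfolding sublinear_def by (meson half_gt_zero zero_less_numeral zero_less_one)+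
  then show ?thesis by simp
qed

lemma sublinear_smult:
  assumes "sublinear E p" "0 \<le> t" "x \<in> carrier E"
  shows "p (t \<odot> x) = t * p x"
proof (cases "t = 0")
  case True then show ?thesis using assms sublinear_zero by simp
next
  case False
  then have t: "t > 0" using assms by simp
  have "p ((1/t) \<odot> (t \<odot> x)) \<le> (1/t) * p (t \<odot> x)"
    using assms t unfolding sublinear_def by (meson smult_in zero_less_divide_1_iff)
  then have "p x \<le> (1/t) * p (t \<odot> x)" using assms t by (simp add: smult_smult)
  then have "t * p x \<le> p (t \<odot> x)" using t by (simp add: field_simps)
  moreover have "p (t \<odot> x) \<le> t * p x" using assms t unfolding sublinear_def by blast
  ultimately show ?thesis by simp
qed

lemma sublinear_add: "sublinear E p \<Longrightarrow> x \<in> carrier E \<Longrightarrow> y \<in> carrier E \<Longrightarrow> p (x \<oplus> y) \<le> p x + p y"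
  unfolding sublinear_def by blast

lemma sublinear_minus_le: 
  assumes "sublinear E p" "x \<in> carrier E" shows "- p (\<ominus> x) \<le> p x"
  using sublinear_add[OF assms(1), of x "\<ominus> x"] assms sublinear_zero[OF assms(1)] by (simp add: r_neg)

text \<open>The largest sublinear functional below \<open>p\<close> whose value at \<open>\<ominus> y\<close> is at most \<open>- p y\<close>.\<close>

definition lower :: "('a \<Rightarrow> real) \<Rightarrow> 'a \<Rightarrow> 'a \<Rightarrow> real" where
  "lower p y x = (if x \<in> carrier E then (INF t\<in>{0..}. p (x \<oplus> t \<odot> y) - t * p y) else 0)"

context
  fixes p y
  assumes p: "sublinear E p" and y: "y \<in> carrier E"
begin

text \<open>Since \<open>t \<odot> y\<close> is the difference of
  \<open>x \<oplus> t \<odot> y\<close> and \<open>x\<close>, subadditivity gives the lower bound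
  \<open>- p (\<ominus> x)\<close> for every \<open>t\<close>.\<close>

lemma lower_bdd:
  assumes x: "x \<in> carrier E"
  shows "bdd_below ((\<lambda>t. p (x \<oplus> t \<odot> y) - t * p y) ` {0..})"
proof (rule bdd_belowI2)
  fix t :: real assume "t \<in> {0..}"
  then have "t * p y = p (t \<odot> y)" using sublinear_smult[OF p] y by simp
  also have "t \<odot> y = (x \<oplus> t \<odot> y) \<oplus> \<ominus> x"
    using x y by (metis a_comm add.inv_closed add.inv_solve_right add.m_closed smult_in)
  also have "p \<dots> \<le> p (x \<oplus> t \<odot> y) + p (\<ominus> x)" using sublinear_add[OF p] x y by simp
  finally show "- p (\<ominus> x) \<le> p (x \<oplus> t \<odot> y) - t * p y" by simp
qed

lemma lower_le: "x \<in> carrier E \<Longrightarrow> 0 \<le> t \<Longrightarrow> lower p y x \<le> p (x \<oplus> t \<odot> y) - t * p y"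
  unfolding lower_def by (auto intro!: cINF_lower2[OF lower_bdd])

lemma lower_greatest:
  "x \<in> carrier E \<Longrightarrow> (\<And>t. 0 \<le> t \<Longrightarrow> m \<le> p (x \<oplus> t \<odot> y) - t * p y) \<Longrightarrow> m \<le> lower p y x"
  unfolding lower_def by (auto intro!: cINF_greatest)

lemma lower_le_self: "x \<in> carrier E \<Longrightarrow> lower p y x \<le> p x"
  using lower_le[of x 0] y by simp

lemma lower_minus: "lower p y (\<ominus> y) \<le> - p y"
  using lower_le[of "\<ominus> y" 1] y sublinear_zero[OF p] by (simp add: l_neg)

text \<open>The parameters of the infimum add and scale along with the vectors: \<open>s + t\<close>
  serves for \<open>a \<oplus> b\<close>, and \<open>s * t\<close> for \<open>s \<odot> a\<close>.
  In the sum, the two infima are taken one after the other.\<close>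

lemma sublinear_lower: "sublinear E (lower p y)"
  unfolding sublinear_def
proof (intro conjI ballI allI impI)
  fix a b assume a: "a \<in> carrier E" and b: "b \<in> carrier E"
  have "lower p y (a \<oplus> b) - (p (b \<oplus> s \<odot> y) - s * p y) \<le> p (a \<oplus> t \<odot> y) - t * p y" if "0 \<le> s" "0 \<le> t" for s t
  proof -
    have "a \<oplus> b \<oplus> (s + t) \<odot> y = (a \<oplus> t \<odot> y) \<oplus> (b \<oplus> s \<odot> y)"
      using a b y by (simp add: smult_add_left a_ac)
    then have "p (a \<oplus> b \<oplus> (s + t) \<odot> y) \<le> p (a \<oplus> t \<odot> y) + p (b \<oplus> s \<odot> y)"
      using sublinear_add[OF p] a b y by simp
    then show ?thesis using lower_le[of "a \<oplus> b" "s + t"] a b that by (simp add: algebra_simps)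
  qed
  then have "lower p y (a \<oplus> b) - (p (b \<oplus> s \<odot> y) - s * p y) \<le> lower p y a" if "0 \<le> s" for s
    using that by (intro lower_greatest a)
  then have "lower p y (a \<oplus> b) - lower p y a \<le> lower p y b"
    by (intro lower_greatest b) (smt (verit))
  then show "lower p y (a \<oplus> b) \<le> lower p y a + lower p y b" by simp
next
  fix s :: real and a assume s: "0 < s" and a: "a \<in> carrier E"
  have "lower p y (s \<odot> a) / s \<le> p (a \<oplus> t \<odot> y) - t * p y" if "0 \<le> t" for t
  proof -
    have "s \<odot> a \<oplus> (s * t) \<odot> y = s \<odot> (a \<oplus> t \<odot> y)"
      using a y by (simp add: smult_add_right smult_smult)
    then have "p (s \<odot> a \<oplus> (s * t) \<odot> y) = s * p (a \<oplus> t \<odot> y)"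
      using sublinear_smult[OF p, of s] s a y by simp
    then have "lower p y (s \<odot> a) \<le> s * (p (a \<oplus> t \<odot> y) - t * p y)"
      using lower_le[of "s \<odot> a" "s * t"] s that a by (simp add: algebra_simps)
    then show ?thesis using s by (simp add: pos_divide_le_eq mult.commute)
  qed
  then have "lower p y (s \<odot> a) / s \<le> lower p y a" by (intro lower_greatest a)
  then show "lower p y (s \<odot> a) \<le> s * lower p y a" using s by (simp add: pos_divide_le_eq mult.commute)
qed

end

text \<open>Zorn's lemma for the reversed order. A chain has its pointwise infimum as a lower bound,
  which is finite because every member is at least \<open>- q (\<ominus> x)\<close> at
  \<open>x\<close>. Minimality is stated for values on the carrier, as competitors need not vanish
  elsewhere.\<close>

lemma minimal_sublinear:
  assumes q: "sublinear E q"
  obtains p where "sublinear E p" "\<And>x. x \<in> carrier E \<Longrightarrow> p x \<le> q x"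
    "\<And>r x. sublinear E r \<Longrightarrow> (\<And>x. x \<in> carrier E \<Longrightarrow> r x \<le> p x) \<Longrightarrow> x \<in> carrier E \<Longrightarrow> r x = p x"
proof -
  \<comment> \<open>The order compares functions on the whole type. The value 0 off the carrier
    reduces it to a comparison on the carrier, and keeps the infima bounded off the carrier
    too.\<close>
  define A where "A = {p. sublinear E p \<and> (\<forall>x\<in>carrier E. p x \<le> q x) \<and> (\<forall>x. x \<notin> carrier E \<longrightarrow> p x = 0)}"
  have po: "partial_order_on A (relation_of (\<lambda>p r. r \<le> p) A)"
    by (rule partial_order_on_relation_ofI) auto
  have "\<exists>m\<in>A. \<forall>a\<in>A. a \<le> m \<longrightarrow> a = m"
  proof (rule predicate_Zorn[OF po])
    fix C assume C: "C \<in> Chains (relation_of (\<lambda>p r. r \<le> p) A)"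
    have CA: "C \<subseteq> A" and tot: "\<And>p r. p \<in> C \<Longrightarrow> r \<in> C \<Longrightarrow> p \<le> r \<or> r \<le> p"
      using C by (auto simp: Chains_def relation_of_def)
    show "\<exists>u\<in>A. \<forall>a\<in>C. u \<le> a"
    proof (cases "C = {}")
      case True
      have "(\<lambda>x. if x \<in> carrier E then q x else 0) \<in> A"
        using q by (auto simp: A_def sublinear_def)
      then show ?thesis using True by blast
    next
      case False
      define u where "u x = (INF p\<in>C. p x)" for x
      have sub: "sublinear E p" if "p \<in> C" for p using that CA by (auto simp: A_def)
      have bdd: "bdd_below ((\<lambda>p. p x) ` C)" for x
      proof (cases "x \<in> carrier E")
        case True
        show ?thesis
        proof (rule bdd_belowI2)
          fix p assume "p \<in> C"
          then have "p (\<ominus> x) \<le> q (\<ominus> x)" using CA True by (auto simp: A_def)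
          then show "- q (\<ominus> x) \<le> p x"
            using sublinear_minus_le[OF sub, of p x] \<open>p \<in> C\<close> True by simp
        qed
      next
        case False
        then show ?thesis using CA by (intro bdd_belowI2[of _ 0]) (auto simp: A_def)
      qed
      have le: "u x \<le> p x" if "p \<in> C" for p x
        unfolding u_def by (rule cINF_lower[OF bdd that])
      have ge: "m \<le> u x" if "\<And>p. p \<in> C \<Longrightarrow> m \<le> p x" for m x
        unfolding u_def using False that by (rule cINF_greatest)
      have "sublinear E u"
        unfolding sublinear_def
      proof (intro conjI ballI allI impI)
        fix x y assume x: "x \<in> carrier E" and y: "y \<in> carrier E"
        \<comment> \<open>Of the comparable \<open>p\<close> and \<open>r\<close>, the smaller one
          is subadditive and lies below \<open>p\<close> at \<open>x\<close> and below
          \<open>r\<close> at \<open>y\<close>. This is the one use of totality of the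
          chain.\<close>
        have *: "u (x \<oplus> y) \<le> p x + r y" if "p \<in> C" "r \<in> C" for p r
          using tot[OF that] le[OF that(1), of "x \<oplus> y"] le[OF that(2), of "x \<oplus> y"]
            sublinear_add[OF sub[OF that(1)] x y] sublinear_add[OF sub[OF that(2)] x y]
          by (smt (verit) le_fun_def)
        have "u (x \<oplus> y) - r y \<le> u x" if "r \<in> C" for r
          using *[OF _ that] by (intro ge) (smt (verit))
        then have "u (x \<oplus> y) - u x \<le> u y" by (intro ge) (smt (verit))
        then show "u (x \<oplus> y) \<le> u x + u y" by simp
      next
        fix t :: real and x assume t: "0 < t" and x: "x \<in> carrier E"
        have "u (t \<odot> x) / t \<le> p x" if "p \<in> C" for p
          using le[OF that, of "t \<odot> x"] sublinear_smult[OF sub[OF that], of t x] t x by (simp add: pos_divide_le_eq mult.commute)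
        then have "u (t \<odot> x) / t \<le> u x" by (rule ge)
        then show "u (t \<odot> x) \<le> t * u x" using t by (simp add: pos_divide_le_eq mult.commute)
      qed
      moreover obtain p where "p \<in> C" using False by blast
      moreover have "u x \<le> q x" if "x \<in> carrier E" for x
        using le[OF \<open>p \<in> C\<close>, of x] CA that \<open>p \<in> C\<close> by (fastforce simp: A_def)
      moreover have "u x = 0" if "x \<notin> carrier E" for x
      proof -
        have "p x = 0" if "p \<in> C" for p using \<open>x \<notin> carrier E\<close> that CA by (auto simp: A_def)
        then have "(\<lambda>p. p x) ` C = (\<lambda>p. 0) ` C" by (intro image_cong) auto
        then show ?thesis using False by (simp add: u_def)
      qed
      ultimately have "u \<in> A" by (auto simp: A_def)
      then show ?thesis using le by (auto simp: le_fun_def)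
    qed
  qed
  then obtain p where pA: "p \<in> A" and min: "\<And>r. r \<in> A \<Longrightarrow> r \<le> p \<Longrightarrow> r = p" by blast
  show thesis
  proof
    show "sublinear E p" "\<And>x. x \<in> carrier E \<Longrightarrow> p x \<le> q x" using pA by (auto simp: A_def)
    fix r x assume r: "sublinear E r" "\<And>x. x \<in> carrier E \<Longrightarrow> r x \<le> p x" and x: "x \<in> carrier E"
    define r' where "r' x = (if x \<in> carrier E then r x else 0)" for x
    have "r' \<in> A" using r pA by (force simp: A_def r'_def sublinear_def)
    moreover have "r' \<le> p" using r pA by (auto simp: A_def r'_def le_fun_def)
    ultimately have "r' = p" by (rule min)
    then have "r' x = p x" by simp
    then show "r x = p x" using x by (simp add: r'_def)
  qed
qed

text \<open>Minimality is applied below \<open>lower nrm z\<close> rather than below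
  \<open>nrm\<close>: this forces \<open>p (\<ominus> z) \<le> - nrm z\<close>, hence
  \<open>nrm z \<le> p z\<close> once \<open>p\<close> is known to be odd.\<close>

lemma norming_functional:
  assumes z: "z \<in> carrier E"
  obtains f where "unit_functional E nrm f" "f z = nrm z"
proof -
  have sn: "sublinear E nrm"
    by (auto simp: sublinear_def nrm_add nrm_smult)
  obtain p where p: "sublinear E p" and pq: "\<And>x. x \<in> carrier E \<Longrightarrow> p x \<le> lower nrm z x"
    and min: "\<And>r x. sublinear E r \<Longrightarrow> (\<And>x. x \<in> carrier E \<Longrightarrow> r x \<le> p x) \<Longrightarrow> x \<in> carrier E \<Longrightarrow> r x = p x"
    using minimal_sublinear[OF sublinear_lower[OF sn z]] by blast
  have le: "p x \<le> nrm x" if "x \<in> carrier E" for x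
    using pq[OF that] lower_le_self[OF sn z that] by simp
  \<comment> \<open>By minimality \<open>lower p y\<close> agrees with \<open>p\<close> on the
    carrier, so its bound at \<open>\<ominus> y\<close> reads
    \<open>p (\<ominus> y) \<le> - p y\<close>. Subadditivity gives the converse.\<close>
  have odd: "p (\<ominus> y) = - p y" if "y \<in> carrier E" for y
  proof -
    have "lower p y (\<ominus> y) = p (\<ominus> y)"
      using that by (intro min sublinear_lower lower_le_self p) auto
    then show ?thesis using lower_minus[OF p that] sublinear_minus_le[OF p that] by simp
  qed
  \<comment> \<open>Oddness turns subadditivity at \<open>\<ominus> x\<close> and
    \<open>\<ominus> y\<close> into superadditivity at \<open>x\<close> and
    \<open>y\<close>.\<close>
  have add: "p (x \<oplus> y) = p x + p y" if "x \<in> carrier E" "y \<in> carrier E" for x y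
  proof -
    have "- p (x \<oplus> y) = p (\<ominus> x \<oplus> \<ominus> y)" using that odd[of "x \<oplus> y"] by (simp add: minus_add)
    also have "\<dots> \<le> - p x - p y" using that sublinear_add[OF p, of "\<ominus> x" "\<ominus> y"] by (simp add: odd)
    finally show ?thesis using sublinear_add[OF p that] by simp
  qed
  have scale: "p (c \<odot> x) = c * p x" if x: "x \<in> carrier E" for c x
  proof (cases "0 \<le> c")
    case True then show ?thesis using sublinear_smult[OF p] x by simp
  next
    case False
    have "c \<odot> x = \<ominus> ((-c) \<odot> x)" using x by (simp add: smult_neg_1[symmetric] smult_smult)
    then show ?thesis using sublinear_smult[OF p, of "-c" x] False x by (simp add: odd)
  qed
  have "norm (p x) \<le> nrm x" if "x \<in> carrier E" for x
    using le[OF that] le[of "\<ominus> x"] that by (simp add: odd)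
  then have "unit_functional E nrm p" using add scale by (simp add: unit_functional_def)
  moreover have "p z = nrm z"
    using pq[of "\<ominus> z"] lower_minus[OF sn z] odd[OF z] le[OF z] z by simp
  ultimately show thesis by (rule that)
qed

end

text \<open>A complex-linear functional is recovered from its real part \<open>f\<close> as
  \<open>f x - \<i> * f (\<i> \<odot> x)\<close>, so the real case suffices, applied to the same
  space with restricted scalars.\<close>

lemma complex_norming_functional:
  fixes E :: "(complex, 'a) module"
  assumes "normed_space E nrm" and z: "z \<in> carrier E"
  obtains f where "unit_functional E nrm f" "f z = nrm z"
proof -
  interpret E: normed E nrm by (rule normed.intro[OF assms(1)])
  define R :: "(real, 'a) module" where
    "R = \<lparr>carrier = carrier E, monoid.mult = undefined, one = undefined,
       ring.zero = \<zero>\<^bsub>E\<^esub>, add = add E, smult = (\<lambda>r. smult E (of_real r))\<rparr>"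
  have sel: "carrier R = carrier E" "add R = add E" "zero R = zero E" "smult R = (\<lambda>r. smult E (of_real r))"
    by (simp_all add: R_def)
  have "abelian_group R"
  proof (rule abelian_groupI)
    fix x assume "x \<in> carrier R"
    then show "\<exists>y\<in>carrier R. y \<oplus>\<^bsub>R\<^esub> x = \<zero>\<^bsub>R\<^esub>"
      by (intro bexI[of _ "\<ominus>\<^bsub>E\<^esub> x"]) (auto simp: sel E.l_neg)
  qed (simp_all add: sel E.a_ac)
  then have "normed_space R nrm"
    unfolding normed_space_def
    by (intro conjI moduleI comm_ring_1_class.cring_from_type_algebra)
       (simp_all add: sel ring_of_type_algebra_def E.smult_add_left E.smult_add_right E.smult_smult
          E.nrm_nonneg E.nrm_eq_0 E.nrm_add E.nrm_smult)
  then interpret R: real_normed R nrm by (intro real_normed.intro normed.intro)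
  obtain f where f: "unit_functional R nrm f" and fz: "f z = nrm z"
    using R.norming_functional z unfolding sel by blast
  have f_add: "f (x \<oplus>\<^bsub>E\<^esub> y) = f x + f y" if "x \<in> carrier E" "y \<in> carrier E" for x y
    using f that by (simp add: unit_functional_def sel)
  have f_smult: "f (of_real r \<odot>\<^bsub>E\<^esub> x) = r * f x" if "x \<in> carrier E" for r x
    using f that by (simp add: unit_functional_def sel)
  have f_le: "f x \<le> nrm x" if "x \<in> carrier E" for x
    using f that by (force simp: unit_functional_def sel)
  define g where "g x = Complex (f x) (- f (\<i> \<odot>\<^bsub>E\<^esub> x))" for x
  have g_add: "g (x \<oplus>\<^bsub>E\<^esub> y) = g x + g y" if "x \<in> carrier E" "y \<in> carrier E" for x y
    using that by (simp add: g_def f_add E.smult_add_right complex_eq_iff)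
  have g_smult: "g (c \<odot>\<^bsub>E\<^esub> x) = c * g x" if x: "x \<in> carrier E" for c x
  proof -
    \<comment> \<open>Applied to \<open>c\<close> and to \<open>\<i> * c\<close>, this computes both
      parts of \<open>g\<close> at the multiple of \<open>x\<close> by \<open>c\<close>.\<close>
    have *: "f (c \<odot>\<^bsub>E\<^esub> x) = Re c * f x + Im c * f (\<i> \<odot>\<^bsub>E\<^esub> x)" for c
    proof -
      have "c \<odot>\<^bsub>E\<^esub> x = of_real (Re c) \<odot>\<^bsub>E\<^esub> x \<oplus>\<^bsub>E\<^esub> of_real (Im c) \<odot>\<^bsub>E\<^esub> (\<i> \<odot>\<^bsub>E\<^esub> x)"
        using x by (simp add: E.smult_smult E.smult_add_left[symmetric] mult.commute flip: complex_eq)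
      then show ?thesis using x by (simp only: f_add f_smult E.smult_in)
    qed
    show ?thesis
      using *[of c] *[of "\<i> * c"] x by (simp add: g_def E.smult_smult complex_eq_iff)
  qed
  have g_le: "norm (g x) \<le> nrm x" if x: "x \<in> carrier E" for x
  proof (cases "g x = 0")
    case True then show ?thesis using E.nrm_nonneg[OF x] by simp
  next
    case False
    \<comment> \<open>The factor \<open>c\<close> of modulus 1 rotates \<open>g x\<close> onto the
      positive axis, where \<open>g\<close> equals its real part and the real bound applies.\<close>
    define c where "c = of_real (norm (g x)) / g x"
    have c: "norm c = 1" using False by (simp add: c_def norm_divide)
    have "g (c \<odot>\<^bsub>E\<^esub> x) = of_real (norm (g x))" using x False by (simp add: g_smult c_def)
    then have "norm (g x) = f (c \<odot>\<^bsub>E\<^esub> x)" by (simp add: g_def complex_eq_iff)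
    also have "\<dots> \<le> nrm x" using f_le[of "c \<odot>\<^bsub>E\<^esub> x"] x c by (simp add: E.nrm_smult)
    finally show ?thesis .
  qed
  \<comment> \<open>The real part \<open>nrm z\<close> already exhausts the bound on the modulus,
    which leaves nothing for the imaginary part.\<close>
  have "Im (g z) = 0"
  proof -
    have "norm (g z) \<le> Re (g z)" using g_le[OF z] fz by (simp add: g_def)
    then have "(Re (g z))\<^sup>2 + (Im (g z))\<^sup>2 \<le> (Re (g z))\<^sup>2"
      by (metis cmod_power2 norm_ge_zero power_mono)
    then show ?thesis by simp
  qed
  then have "g z = nrm z" using fz by (simp add: g_def complex_eq_iff)
  moreover have "unit_functional E nrm g" using g_add g_smult g_le by (simp add: unit_functional_def)
  ultimately show thesis by (rule that[rotated])
qed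

section \<open>The projective norm on the tensor product\<close>

lemma lookup_map_times [simp]:
  "Poly_Mapping.lookup (Poly_Mapping.map ((*) c) p) k = (c::'k::field) * Poly_Mapping.lookup p k"
  by (simp add: Poly_Mapping.map.rep_eq when_def)

lemma keys_map_times: "Poly_Mapping.keys (Poly_Mapping.map ((*) (c::'k::field)) p) \<subseteq> Poly_Mapping.keys p"
  by (auto simp: in_keys_iff)

lemma map_times_single [simp]:
  "Poly_Mapping.map ((*) (c::'k::field)) (Poly_Mapping.single x a) = Poly_Mapping.single x (c * a)"
  by (rule poly_mapping_eqI) (simp add: lookup_single when_def)

lemma free_space_simps [simp]:
  "carrier (free_space n E) = {p. Poly_Mapping.keys p \<subseteq> tuples n E}"
  "add (free_space n E) = (+)" "zero (free_space n E) = 0"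
  "smult (free_space n E) = (\<lambda>c. Poly_Mapping.map ((*) c))"
  by (simp_all add: free_space_def)

lemma module_free_space: "module (ring_of_type_algebra :: 'k::field ring) (free_space n (E :: nat \<Rightarrow> ('k, 'a) module))"
proof (rule moduleI)
  show "abelian_group (free_space n E)"
  proof (rule abelian_groupI)
    fix p assume "p \<in> carrier (free_space n E)"
    then show "\<exists>q\<in>carrier (free_space n E). q \<oplus>\<^bsub>free_space n E\<^esub> p = \<zero>\<^bsub>free_space n E\<^esub>"
      by (intro bexI[of _ "- p"]) auto
  qed (use keys_add in \<open>fastforce simp: algebra_simps\<close>)+
next
  fix a :: 'k and p assume "p \<in> carrier (free_space n E)"
  then show "a \<odot>\<^bsub>free_space n E\<^esub> p \<in> carrier (free_space n E)"
    using keys_map_times[of a p] by auto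
next
  show "cring (ring_of_type_algebra :: 'k ring)"
    by (rule comm_ring_1_class.cring_from_type_algebra)
qed (auto simp: ring_of_type_algebra_def lookup_add algebra_simps intro!: poly_mapping_eqI)

lemma free_space_a_inv [simp]:
  assumes "Poly_Mapping.keys p \<subseteq> tuples n E"
  shows "a_inv (free_space n E) p = - p"
proof -
  interpret module ring_of_type_algebra "free_space n E" by (rule module_free_space)
  show ?thesis using assms minus_equality[of "- p" p] by simp
qed

text \<open>Negation is scaling by -1, so closure under it need not be listed. All later facts about
  the kernel use this form.\<close>

lemma submodule_free_space_iff:
  "submodule N (ring_of_type_algebra :: 'k ring) (free_space n (E :: nat \<Rightarrow> ('k::field, 'a) module)) \<longleftrightarrow>
     (\<forall>p\<in>N. Poly_Mapping.keys p \<subseteq> tuples n E) \<and> 0 \<in> N \<and> (\<forall>p\<in>N. \<forall>q\<in>N. p + q \<in> N) \<and>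
     (\<forall>c. \<forall>p\<in>N. Poly_Mapping.map ((*) c) p \<in> N)" (is "?L \<longleftrightarrow> ?R")
proof
  interpret module "ring_of_type_algebra :: 'k ring" "free_space n E" by (rule module_free_space)
  show ?R if L: ?L
  proof -
    interpret subgroup N "add_monoid (free_space n E)" using L by (simp add: submodule_def)
    show ?thesis
      using subset one_closed m_closed submodule.smult_closed[OF L]
      by (auto simp: ring_of_type_algebra_def)
  qed
  show ?L if R: ?R
  proof (rule submoduleI)
    fix p assume p: "p \<in> N"
    have "Poly_Mapping.map ((*) (-1)) p = - p" by (rule poly_mapping_eqI) simp
    then show "a_inv (free_space n E) p \<in> N" using R p by (metis free_space_a_inv)
  qed (use R in auto)
qed

lemma tuples_upd: "x \<in> tuples n E \<Longrightarrow> i \<in> {1..n} \<Longrightarrow> a \<in> carrier (E i) \<Longrightarrow> x(i := a) \<in> tuples n E"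
  by (metis PiE_fun_upd insert_absorb)

text \<open>The way to prove a property of all kernel elements: the free vectors that have it form a
  submodule containing the relators.\<close>

lemma multilinear_kernel_minimal:
  assumes "submodule N ring_of_type_algebra (free_space n E)" "multilinear_relators n E \<subseteq> N"
  shows "multilinear_kernel n E \<subseteq> N"
  unfolding multilinear_kernel_def using assms by (intro hull_minimal)

definition coset :: "nat \<Rightarrow> (nat \<Rightarrow> ('k::field, 'a) module) \<Rightarrow> ((nat \<Rightarrow> 'a) \<Rightarrow>\<^sub>0 'k) \<Rightarrow> ((nat \<Rightarrow> 'a) \<Rightarrow>\<^sub>0 'k) set" where
  "coset n E p = multilinear_kernel n E +>\<^bsub>free_space n E\<^esub> p"

lemma prod_fun_upd:
  assumes "finite A" "i \<in> A"
  shows "(\<Prod>j\<in>A. f j ((x(i := a)) j)) = f i a * (\<Prod>j\<in>A - {i}. f j (x j))"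
proof -
  have "(\<Prod>j\<in>A - {i}. f j ((x(i := a)) j)) = (\<Prod>j\<in>A - {i}. f j (x j))"
    by (intro prod.cong) auto
  then show ?thesis using prod.remove[OF assms, of "\<lambda>j. f j ((x(i := a)) j)"] by simp
qed

lemma sum_lessThan_append:
  "(\<Sum>j<m + k. f j) = (\<Sum>j<m. f j) + (\<Sum>j<k. f (m + j) :: 'b::comm_monoid_add)" for m k :: nat
  by (induction k) (simp_all add: ac_simps)

definition linear_extension :: "('x \<Rightarrow> 'k::field) \<Rightarrow> ('x \<Rightarrow>\<^sub>0 'k) \<Rightarrow> 'k" where
  "linear_extension G p = (\<Sum>x\<in>Poly_Mapping.keys p. Poly_Mapping.lookup p x * G x)"

text \<open>Keys can cancel in a sum and vanish under the scalar 0, so linearity is computed over a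
  common finite set of tuples instead of the keys.\<close>

lemma linear_extension_superset:
  assumes "finite A" "Poly_Mapping.keys p \<subseteq> A"
  shows "linear_extension G p = (\<Sum>x\<in>A. Poly_Mapping.lookup p x * G x)"
  unfolding linear_extension_def using assms
  by (intro sum.mono_neutral_left) (auto simp: in_keys_iff)

lemma linear_extension_add: "linear_extension G (p + q) = linear_extension G p + linear_extension G q"
proof -
  let ?A = "Poly_Mapping.keys p \<union> Poly_Mapping.keys q"
  have "linear_extension G r = (\<Sum>x\<in>?A. Poly_Mapping.lookup r x * G x)" if "r \<in> {p, q, p + q}" for r
    using that keys_add[of p q] by (intro linear_extension_superset) auto
  then show ?thesis by (simp add: lookup_add algebra_simps sum.distrib)
qed

lemma linear_extension_map_times: "linear_extension G (Poly_Mapping.map ((*) c) p) = c * linear_extension G p"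
  using linear_extension_superset[of "Poly_Mapping.keys p" "Poly_Mapping.map ((*) c) p" G] keys_map_times[of c p]
  by (simp add: linear_extension_def sum_distrib_left mult.assoc)

lemma linear_extension_0 [simp]: "linear_extension G 0 = 0"
  by (simp add: linear_extension_def)

lemma linear_extension_single [simp]: "linear_extension G (Poly_Mapping.single x c) = c * G x"
  by (simp add: linear_extension_def)

lemma linear_extension_diff: "linear_extension G (p - q) = linear_extension G p - linear_extension G q"
  using linear_extension_add[of G "p - q" q] by simp

lemma linear_extension_sum: "linear_extension G (\<Sum>j\<in>A. f j) = (\<Sum>j\<in>A. linear_extension G (f j))"
  by (induction A rule: infinite_finite_induct) (simp_all add: linear_extension_add)

section \<open>The tensor product as a quotient of the free space\<close>

locale normed_family =
  fixes n :: nat and E :: "nat \<Rightarrow> ('k::real_normed_field, 'a) module" and nrm :: "nat \<Rightarrow> 'a \<Rightarrow> real"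
  assumes n_pos: "1 \<le> n" and spaces: "\<And>i. i \<in> {1..n} \<Longrightarrow> normed_space (E i) (nrm i)"
begin

abbreviation N where "N \<equiv> multilinear_kernel n E"
abbreviation FS where "FS \<equiv> free_space n E"
abbreviation TP where "TP \<equiv> tensor_product n E"
definition free_vec :: "((nat \<Rightarrow> 'a) \<Rightarrow>\<^sub>0 'k) \<Rightarrow> bool" where
  "free_vec p \<longleftrightarrow> Poly_Mapping.keys p \<subseteq> tuples n E"

lemma normed: "i \<in> {1..n} \<Longrightarrow> normed (E i) (nrm i)"
  using spaces by (rule normed.intro)

lemma free_vec_add [simp]: "free_vec p \<Longrightarrow> free_vec q \<Longrightarrow> free_vec (p + q)"
  unfolding free_vec_def using keys_add[of p q] by blast

lemma free_vec_diff [simp]: "free_vec p \<Longrightarrow> free_vec q \<Longrightarrow> free_vec (p - q)"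
  unfolding free_vec_def using keys_diff[of p q] by blast

lemma free_vec_uminus [simp]: "free_vec (- p) \<longleftrightarrow> free_vec p"
  unfolding free_vec_def by simp

lemma free_vec_map_times [simp]: "free_vec p \<Longrightarrow> free_vec (Poly_Mapping.map ((*) c) p)"
  unfolding free_vec_def using keys_map_times[of c p] by blast

lemma free_vec_0 [simp]: "free_vec 0"
  unfolding free_vec_def by simp

lemma free_vec_sum [simp]: "(\<And>j. j \<in> A \<Longrightarrow> free_vec (f j)) \<Longrightarrow> free_vec (sum f A)"
  by (induction A rule: infinite_finite_induct) simp_all

lemma free_vec_single [simp]: "x \<in> tuples n E \<Longrightarrow> free_vec (Poly_Mapping.single x c)"
  unfolding free_vec_def by simp

lemma relators_free: "multilinear_relators n E \<subseteq> {p. free_vec p}"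
proof -
  have "a \<oplus>\<^bsub>E i\<^esub> b \<in> carrier (E i)" if "i \<in> {1..n}" "a \<in> carrier (E i)" "b \<in> carrier (E i)" for i a b
  proof -
    interpret normed "E i" "nrm i" by (rule normed[OF that(1)])
    show ?thesis using that by simp
  qed
  then show ?thesis
    unfolding multilinear_relators_def
    by (auto intro!: free_vec_diff free_vec_single tuples_upd simp: normed.smult_in[OF normed])
qed

lemma submodule_carrier: "submodule {p. free_vec p} (ring_of_type_algebra :: 'k ring) FS"
  unfolding submodule_free_space_iff unfolding free_vec_def[symmetric] by simp

text \<open>A hull is an intersection, which is the whole type if the family is empty. Here the
  family contains the carrier, because the relators are free vectors, and this also puts the kernel
  inside the carrier.\<close>

lemma kernel_submodule: "submodule N (ring_of_type_algebra :: 'k ring) FS"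
proof -
  have sub: "N \<subseteq> {p. free_vec p}"
    by (intro multilinear_kernel_minimal submodule_carrier relators_free)
  moreover have "N = \<Inter>{t. submodule t (ring_of_type_algebra :: 'k ring) FS \<and> multilinear_relators n E \<subseteq> t}"
    by (simp add: multilinear_kernel_def hull_def)
  ultimately show ?thesis
    unfolding submodule_free_space_iff free_vec_def by auto
qed

lemma kernel_free: "p \<in> N \<Longrightarrow> free_vec p"
  and kernel_0: "0 \<in> N"
  and kernel_add: "p \<in> N \<Longrightarrow> q \<in> N \<Longrightarrow> p + q \<in> N"
  and kernel_map_times: "p \<in> N \<Longrightarrow> Poly_Mapping.map ((*) c) p \<in> N"
  using kernel_submodule unfolding submodule_free_space_iff free_vec_def by blast+

lemma kernel_uminus: "p \<in> N \<Longrightarrow> - p \<in> N"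
proof -
  have "Poly_Mapping.map ((*) (-1)) p = - p" by (rule poly_mapping_eqI) simp
  then show "p \<in> N \<Longrightarrow> - p \<in> N" by (metis kernel_map_times)
qed

lemma kernel_diff: "p \<in> N \<Longrightarrow> q \<in> N \<Longrightarrow> p - q \<in> N"
  using kernel_add[of p "- q"] kernel_uminus by simp

lemma kernel_relators: "multilinear_relators n E \<subseteq> N"
  unfolding multilinear_kernel_def by (rule hull_subset)

end

sublocale normed_family \<subseteq> FS: module "ring_of_type_algebra :: 'k ring" "free_space n E"
  by (rule module_free_space)

sublocale normed_family \<subseteq> N: abelian_subgroup "multilinear_kernel n E" "free_space n E"
  using kernel_submodule
  by (intro abelian_subgroupI3 additive_subgroupI FS.abelian_group_axioms) (simp add: submodule_def)

context normed_family
begin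

text \<open>Equations between tensors become membership of a difference in \<open>N\<close>, which
  is how they are treated from here on.\<close>

lemma coset_eq_iff:
  assumes "free_vec p" "free_vec q"
  shows "coset n E p = coset n E q \<longleftrightarrow> p - q \<in> N"
proof -
  have "p \<in> coset n E q \<longleftrightarrow> p - q \<in> N"
    unfolding coset_def using assms N.a_rcos_module[of q p] by (simp add: free_vec_def)
  moreover have "coset n E p = coset n E q \<longleftrightarrow> p \<in> coset n E q"
    unfolding coset_def using assms N.a_repr_independence'[of p q] N.a_rcos_self[of p] by (auto simp: free_vec_def)
  ultimately show ?thesis by blast
qed

lemma tensor_product_carrier: "carrier TP = coset n E ` {p. free_vec p}"
  by (auto simp: tensor_product_def Let_def A_RCOSETS_def' coset_def free_vec_def)

lemma tensor_product_add:
  "free_vec p \<Longrightarrow> free_vec q \<Longrightarrow> coset n E p \<oplus>\<^bsub>TP\<^esub> coset n E q = coset n E (p + q)"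
  using N.a_rcos_sum[of p q] by (simp add: tensor_product_def Let_def coset_def free_vec_def)

lemma tensor_product_zero: "\<zero>\<^bsub>TP\<^esub> = coset n E 0"
  using FS.a_coset_add_zero[of N] kernel_free by (simp add: tensor_product_def Let_def coset_def free_vec_def subset_iff)

lemma abelian_group_tensor_product: "abelian_group TP"
proof (rule abelian_groupI)
  fix z assume "z \<in> carrier TP"
  then obtain p where p: "free_vec p" "z = coset n E p" by (auto simp: tensor_product_carrier)
  then show "\<exists>y\<in>carrier TP. y \<oplus>\<^bsub>TP\<^esub> z = \<zero>\<^bsub>TP\<^esub>"
    by (intro bexI[of _ "coset n E (- p)"])
       (simp_all add: tensor_product_add tensor_product_zero tensor_product_carrier)
qed (auto simp: tensor_product_carrier tensor_product_zero tensor_product_add free_vec_add ac_simps)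

lemma tensor_product_diff:
  assumes "free_vec p" "free_vec q"
  shows "coset n E p \<ominus>\<^bsub>TP\<^esub> coset n E q = coset n E (p - q)"
proof -
  interpret TP: abelian_group TP by (rule abelian_group_tensor_product)
  have "\<ominus>\<^bsub>TP\<^esub> coset n E q = coset n E (- q)"
    using assms by (intro TP.minus_equality)
      (simp_all add: tensor_product_add tensor_product_zero tensor_product_carrier)
  then show ?thesis using assms tensor_product_add[of p "- q"] by (simp add: a_minus_def)
qed

section \<open>Representations by elementary tensors and the projective distance\<close>

lemma elementary_tensor_eq: "elementary_tensor n E x = coset n E (basis_vec x)"
  by (simp add: elementary_tensor_def coset_def)

lemma finsum_elementary:
  fixes m :: nat
  assumes "\<forall>j<m. x j \<in> tuples n E"
  shows "(\<Oplus>\<^bsub>TP\<^esub> j\<in>{..<m}. elementary_tensor n E (x j)) = coset n E (\<Sum>j<m. basis_vec (x j))"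
  using assms
proof (induction m)
  interpret TP: abelian_group TP by (rule abelian_group_tensor_product)
  case 0 show ?case by (simp add: tensor_product_zero)
next
  interpret TP: abelian_group TP by (rule abelian_group_tensor_product)
  case (Suc m)
  have "(\<lambda>j. elementary_tensor n E (x j)) \<in> {..<m} \<rightarrow> carrier TP"
    "elementary_tensor n E (x m) \<in> carrier TP"
    using Suc.prems by (auto simp: elementary_tensor_eq tensor_product_carrier free_vec_single simp del: keys_single)
  moreover have "free_vec (\<Sum>j<m. basis_vec (x j))" 
    using Suc.prems by (intro free_vec_sum free_vec_single) auto
  moreover have "free_vec (basis_vec (x m))"
    using Suc.prems by (intro free_vec_single) auto
  moreover have "(\<Oplus>\<^bsub>TP\<^esub> j\<in>{..<m}. elementary_tensor n E (x j)) = coset n E (\<Sum>j<m. basis_vec (x j))"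
    using Suc by simp
  ultimately show ?case
    by (simp add: lessThan_Suc elementary_tensor_eq tensor_product_add)
qed

text \<open>The values whose infimum is the projective norm, attached to a free vector instead of
  its class.\<close>

definition reps :: "((nat \<Rightarrow> 'a) \<Rightarrow>\<^sub>0 'k) \<Rightarrow> real set" where
  "reps p = {\<Sum>j<m. \<Prod>i\<in>{1..n}. nrm i (x j i) | (m::nat) x.
     (\<forall>j<m. x j \<in> tuples n E) \<and> p - (\<Sum>j<m. basis_vec (x j)) \<in> N}"

lemma projective_norm_coset:
  assumes "free_vec p"
  shows "projective_norm n E nrm (coset n E p) = Inf (reps p)"
proof -
  have "coset n E p = (\<Oplus>\<^bsub>TP\<^esub> j\<in>{..<m}. elementary_tensor n E (x j)) \<longleftrightarrow> p - (\<Sum>j<m. basis_vec (x j)) \<in> N"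
    if "\<forall>j<m. x j \<in> tuples n E" for m :: nat and x
    unfolding finsum_elementary[OF that]
    using assms that by (intro coset_eq_iff free_vec_sum free_vec_single) auto
  then show ?thesis
    unfolding projective_norm_def reps_def by (intro arg_cong[of _ _ Inf]) blast
qed

lemma nrm_nonneg: "x \<in> tuples n E \<Longrightarrow> i \<in> {1..n} \<Longrightarrow> 0 \<le> nrm i (x i)"
  using normed.nrm_nonneg[OF normed] by (auto simp: PiE_def Pi_def)

lemma reps_nonneg: "s \<in> reps p \<Longrightarrow> 0 \<le> s"
  unfolding reps_def by clarify (intro sum_nonneg prod_nonneg nrm_nonneg, simp_all)

lemma reps_bdd: "bdd_below (reps p)"
  using reps_nonneg by (rule bdd_belowI)

text \<open>Concatenation of representations; this is the triangle inequality before infima are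
  taken.\<close>

lemma reps_add:
  assumes "s \<in> reps p" "t \<in> reps q"
  shows "s + t \<in> reps (p + q)"
proof -
  obtain m :: nat and x where s: "s = (\<Sum>j<m. \<Prod>i\<in>{1..n}. nrm i (x j i))" "\<forall>j<m. x j \<in> tuples n E"
    "p - (\<Sum>j<m. basis_vec (x j)) \<in> N" using assms(1) unfolding reps_def by blast
  obtain k :: nat and y where t: "t = (\<Sum>j<k. \<Prod>i\<in>{1..n}. nrm i (y j i))" "\<forall>j<k. y j \<in> tuples n E"
    "q - (\<Sum>j<k. basis_vec (y j)) \<in> N" using assms(2) unfolding reps_def by blast
  define z where "z j = (if j < m then x j else y (j - m))" for j
  have "p + q - (\<Sum>j<m + k. basis_vec (z j)) = (p - (\<Sum>j<m. basis_vec (x j))) + (q - (\<Sum>j<k. basis_vec (y j)))"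
    by (simp add: sum_lessThan_append z_def)
  then have "p + q - (\<Sum>j<m + k. basis_vec (z j)) \<in> N"
    using kernel_add[OF s(3) t(3)] by (simp only:)
  moreover have "s + t = (\<Sum>j<m + k. \<Prod>i\<in>{1..n}. nrm i (z j i))"
    by (simp add: sum_lessThan_append z_def s(1) t(1))
  moreover have "\<forall>j<m + k. z j \<in> tuples n E" using s(2) t(2) by (auto simp: z_def)
  ultimately show ?thesis unfolding reps_def by blast
qed

lemma reps_cong:
  assumes "p - q \<in> N" shows "reps p = reps q"
proof -
  have "p - r \<in> N \<longleftrightarrow> q - r \<in> N" for r
    using assms kernel_diff[of "p - r" "p - q"] kernel_add[of "q - r" "p - q"] by auto
  then show ?thesis unfolding reps_def by simp
qed

lemma reps_basis:
  assumes "x \<in> tuples n E" shows "(\<Prod>i\<in>{1..n}. nrm i (x i)) \<in> reps (basis_vec x)"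
proof -
  have "(\<Sum>j<1::nat. \<Prod>i\<in>{1..n}. nrm i ((\<lambda>_. x) j i)) \<in> reps (basis_vec x)"
    unfolding reps_def using assms kernel_0 by (intro CollectI exI[of _ "1::nat"] exI[of _ "\<lambda>_. x"]) auto
  then show ?thesis by simp
qed

lemma kernel_scale:
  assumes "x \<in> tuples n E" "i \<in> {1..n}" "a \<in> carrier (E i)"
  shows "basis_vec (x(i := c \<odot>\<^bsub>E i\<^esub> a)) - Poly_Mapping.map ((*) c) (basis_vec (x(i := a))) \<in> N"
  using assms kernel_relators unfolding multilinear_relators_def by blast

lemma kernel_additive:
  assumes "x \<in> tuples n E" "i \<in> {1..n}" "a \<in> carrier (E i)" "b \<in> carrier (E i)"
  shows "basis_vec (x(i := a \<oplus>\<^bsub>E i\<^esub> b)) - basis_vec (x(i := a)) - basis_vec (x(i := b)) \<in> N"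
  using assms kernel_relators unfolding multilinear_relators_def by blast

lemma kernel_neg:
  assumes "x \<in> tuples n E" "i \<in> {1..n}"
  shows "basis_vec (x(i := \<ominus>\<^bsub>E i\<^esub> x i)) + basis_vec x \<in> N"
proof -
  have xi: "x i \<in> carrier (E i)" using assms by auto
  have "basis_vec (x(i := \<ominus>\<^bsub>E i\<^esub> x i)) - Poly_Mapping.map ((*) (- 1)) (basis_vec (x(i := x i))) \<in> N"
    using kernel_scale[OF assms xi, of "-1"] normed.smult_neg_1[OF normed xi] assms by simp
  then show ?thesis by (simp add: single_uminus)
qed

text \<open>Representations carry no scalars, so the sign goes into coordinate 1, where it does not
  change the norm. This yields the symmetry of the distance.\<close>

lemma reps_uminus:
  assumes "s \<in> reps p"
  shows "s \<in> reps (- p)"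
proof -
  obtain m :: nat and x where s: "s = (\<Sum>j<m. \<Prod>i\<in>{1..n}. nrm i (x j i))" "\<forall>j<m. x j \<in> tuples n E"
    "p - (\<Sum>j<m. basis_vec (x j)) \<in> N" using assms(1) unfolding reps_def by blast
  define y where "y j = (x j)(1 := \<ominus>\<^bsub>E 1\<^esub> x j 1)" for j
  have 1: "1 \<in> {1..n}" using n_pos by simp
  interpret E1: normed "E 1" "nrm 1" by (rule normed[OF 1])
  have xc: "x j 1 \<in> carrier (E 1)" if "j < m" for j using s(2) 1 that by (blast dest: PiE_mem)
  have y: "\<forall>j<m. y j \<in> tuples n E"
  proof (intro allI impI)
    fix j assume "j < m"
    then show "y j \<in> tuples n E"
      unfolding y_def using s(2) E1.a_inv_closed[OF xc] by (intro tuples_upd 1) blast+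
  qed
  have sum_mem: "(\<Sum>j<k. basis_vec (y j) + basis_vec (x j)) \<in> N" if "k \<le> m" for k
    using that
  proof (induction k)
    case (Suc k)
    have "basis_vec (y k) + basis_vec (x k) \<in> N"
      unfolding y_def using s(2) Suc.prems by (intro kernel_neg 1) simp
    then show ?case using Suc kernel_add by simp
  qed (simp add: kernel_0)
  have "- p - (\<Sum>j<m. basis_vec (y j)) = - (p - (\<Sum>j<m. basis_vec (x j))) - (\<Sum>j<m. basis_vec (y j) + basis_vec (x j))"
    by (simp add: sum.distrib)
  then have "- p - (\<Sum>j<m. basis_vec (y j)) \<in> N"
    using kernel_diff[OF kernel_uminus[OF s(3)] sum_mem[of m]] by (simp only: order_refl)
  moreover have "(\<Prod>i\<in>{1..n}. nrm i (y j i)) = (\<Prod>i\<in>{1..n}. nrm i (x j i))" if "j < m" for j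
    using E1.nrm_minus[OF xc[OF that]] by (intro prod.cong) (auto simp: y_def)
  then have "s = (\<Sum>j<m. \<Prod>i\<in>{1..n}. nrm i (y j i))" using s(1) by simp
  ultimately show ?thesis unfolding reps_def using y by blast
qed

lemma kernel_trans: "p - q \<in> N \<Longrightarrow> q - r \<in> N \<Longrightarrow> p - r \<in> N"
  using kernel_add[of "p - q" "q - r"] by simp

lemma reps_zero: "0 \<in> reps 0"
proof -
  have "(\<Sum>j<(0::nat). \<Prod>i\<in>{1..n}. nrm i ((undefined :: nat \<Rightarrow> nat \<Rightarrow> 'a) j i)) \<in> reps 0"
    unfolding reps_def using kernel_0
    by (intro CollectI exI[of _ "0::nat"] exI[of _ "undefined :: nat \<Rightarrow> nat \<Rightarrow> 'a"]) simp
  then show ?thesis by simp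
qed

text \<open>An infimum over no representations would be meaningless. Each coefficient of
  \<open>p\<close> is absorbed into coordinate 1, which exists because of
  \<open>1 \<le> n\<close>.\<close>

lemma reps_nonempty:
  assumes "free_vec p" shows "reps p \<noteq> {}"
proof -
  have single: "reps (Poly_Mapping.single x c) \<noteq> {}" if x: "x \<in> tuples n E" for x c
  proof -
    have 1: "1 \<in> {1..n}" using n_pos by simp
    have x1: "x 1 \<in> carrier (E 1)" using x 1 by (rule PiE_mem)
    have "basis_vec (x(1 := c \<odot>\<^bsub>E 1\<^esub> x 1)) - Poly_Mapping.single x c \<in> N"
      using kernel_scale[OF x 1 x1, of c] by (simp only: fun_upd_triv map_times_single mult_1_right)
    moreover have "x(1 := c \<odot>\<^bsub>E 1\<^esub> x 1) \<in> tuples n E"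
      using x 1 normed.smult_in[OF normed[OF 1] x1] by (rule tuples_upd)
    ultimately show ?thesis using reps_cong reps_basis by blast
  qed
  have "reps (\<Sum>x\<in>A. Poly_Mapping.single x (Poly_Mapping.lookup p x)) \<noteq> {}" if "finite A" "A \<subseteq> tuples n E" for A
    using that
  proof (induction A rule: finite_induct)
    case empty then show ?case using reps_zero by auto
  next
    case (insert x A)
    then obtain s t where "s \<in> reps (Poly_Mapping.single x (Poly_Mapping.lookup p x))"
      "t \<in> reps (\<Sum>x\<in>A. Poly_Mapping.single x (Poly_Mapping.lookup p x))"
      using single[of x "Poly_Mapping.lookup p x"] by blast
    then have "s + t \<in> reps (\<Sum>x\<in>insert x A. Poly_Mapping.single x (Poly_Mapping.lookup p x))"
      using insert reps_add by simp
    then show ?case by blast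
  qed
  moreover have "(\<Sum>x\<in>Poly_Mapping.keys p. Poly_Mapping.single x (Poly_Mapping.lookup p x)) = p"
    by (rule poly_mapping_eqI) (simp add: lookup_sum lookup_single when_def in_keys_iff)
  ultimately show ?thesis
    using assms by (metis finite_keys free_vec_def)
qed

lemma Inf_reps_nonneg: "free_vec p \<Longrightarrow> 0 \<le> Inf (reps p)"
  using reps_nonempty reps_nonneg by (intro cInf_greatest)

lemma Inf_reps_add:
  assumes "free_vec p" "free_vec q" shows "Inf (reps (p + q)) \<le> Inf (reps p) + Inf (reps q)"
proof -
  have *: "Inf (reps (p + q)) \<le> s + t" if "s \<in> reps p" "t \<in> reps q" for s t
    using reps_add[OF that] reps_bdd by (rule cInf_lower)
  have "Inf (reps (p + q)) - t \<le> Inf (reps p)" if "t \<in> reps q" for t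
    using assms *[OF _ that] by (intro cInf_greatest reps_nonempty) (auto simp: diff_le_eq)
  then have "Inf (reps (p + q)) - Inf (reps p) \<le> Inf (reps q)"
    using assms by (intro cInf_greatest reps_nonempty) (auto simp: algebra_simps)
  then show ?thesis by simp
qed

lemma projective_dist_coset:
  assumes "free_vec p" "free_vec q"
  shows "projective_dist n E nrm (coset n E p) (coset n E q) = Inf (reps (p - q))"
proof -
  have "coset n E p \<in> carrier TP" "coset n E q \<in> carrier TP"
    using assms by (simp_all add: tensor_product_carrier)
  then show ?thesis
    using assms by (simp add: projective_dist_def induced_dist_def tensor_product_diff projective_norm_coset)
qed

lemma projective_dist_nonneg: "0 \<le> projective_dist n E nrm z w"
proof (cases "z \<in> carrier TP \<and> w \<in> carrier TP")
  case True
  then obtain p q where "free_vec p" "z = coset n E p" "free_vec q" "w = coset n E q"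
    by (auto simp: tensor_product_carrier)
  then show ?thesis by (simp add: projective_dist_coset Inf_reps_nonneg)
qed (auto simp add: projective_dist_def induced_dist_def)

lemma projective_dist_commute: "projective_dist n E nrm z w = projective_dist n E nrm w z"
proof (cases "z \<in> carrier TP \<and> w \<in> carrier TP")
  case True
  then obtain p q where "free_vec p" "z = coset n E p" "free_vec q" "w = coset n E q"
    by (auto simp: tensor_product_carrier)
  moreover have "reps (p - q) = reps (q - p)"
    using reps_uminus[of _ "p - q"] reps_uminus[of _ "q - p"] by auto
  ultimately show ?thesis by (simp add: projective_dist_coset)
qed (auto simp: projective_dist_def induced_dist_def)

text \<open>The distance pulled back to tuples, where it is only a pseudometric. Estimates on
  coordinates refer to tuples, and different tuples may represent the same tensor.\<close>

definition tdist :: "(nat \<Rightarrow> 'a) \<Rightarrow> (nat \<Rightarrow> 'a) \<Rightarrow> real" where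
  "tdist x y = projective_dist n E nrm (elementary_tensor n E x) (elementary_tensor n E y)"

lemma tdist_eq:
  "x \<in> tuples n E \<Longrightarrow> y \<in> tuples n E \<Longrightarrow> tdist x y = Inf (reps (basis_vec x - basis_vec y))"
  by (simp add: tdist_def elementary_tensor_eq projective_dist_coset)

lemma tdist_nonneg: "0 \<le> tdist x y"
  by (simp add: tdist_def projective_dist_nonneg)

lemma tdist_triangle:
  assumes "x \<in> tuples n E" "y \<in> tuples n E" "z \<in> tuples n E"
  shows "tdist x z \<le> tdist x y + tdist y z"
  using assms Inf_reps_add[of "basis_vec x - basis_vec y" "basis_vec y - basis_vec z"]
  by (simp add: tdist_eq)

lemma elementary_tensor_eq_iff:
  assumes "x \<in> tuples n E" "y \<in> tuples n E"
  shows "elementary_tensor n E x = elementary_tensor n E y \<longleftrightarrow> basis_vec x - basis_vec y \<in> N"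
  unfolding elementary_tensor_eq using assms by (intro coset_eq_iff) simp_all

lemma tdist_self: "x \<in> tuples n E \<Longrightarrow> tdist x x = 0"
  using cInf_lower[OF reps_zero reps_bdd] tdist_nonneg[of x x] by (simp add: tdist_eq)

text \<open>Tensors that differ in a single coordinate have a decomposable difference, and its
  one-term representation bounds the distance.\<close>

lemma tdist_upd:
  assumes x: "x \<in> tuples n E" and i: "i \<in> {1..n}" and a: "a \<in> carrier (E i)"
  shows "tdist x (x(i := a)) \<le> nrm i (x i \<ominus>\<^bsub>E i\<^esub> a) * (\<Prod>j\<in>{1..n} - {i}. nrm j (x j))"
proof -
  interpret Ei: normed "E i" "nrm i" by (rule normed[OF i])
  define b where "b = x i \<ominus>\<^bsub>E i\<^esub> a"
  have xi: "x i \<in> carrier (E i)" using x i by (rule PiE_mem)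
  have b: "b \<in> carrier (E i)" unfolding b_def using xi a by simp
  have "a \<oplus>\<^bsub>E i\<^esub> b = x i"
    unfolding b_def a_minus_def using Ei.a_lcomm[of a "x i" "\<ominus>\<^bsub>E i\<^esub> a"] xi a by (simp add: Ei.r_neg)
  then have "basis_vec x - basis_vec (x(i := a)) - basis_vec (x(i := b)) \<in> N"
    using kernel_additive[OF x i a b] by simp
  then have "reps (basis_vec x - basis_vec (x(i := a))) = reps (basis_vec (x(i := b)))"
    by (rule reps_cong)
  then have "(\<Prod>j\<in>{1..n}. nrm j ((x(i := b)) j)) \<in> reps (basis_vec x - basis_vec (x(i := a)))"
    using reps_basis[OF tuples_upd[OF x i b]] by simp
  then have "Inf (reps (basis_vec x - basis_vec (x(i := a)))) \<le> (\<Prod>j\<in>{1..n}. nrm j ((x(i := b)) j))"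
    using reps_bdd by (rule cInf_lower)
  then show ?thesis
    unfolding tdist_eq[OF x tuples_upd[OF x i a]] prod_fun_upd[OF finite_atLeastAtMost i] b_def .
qed

text \<open>Each scaling relator pulls one factor out, by induction on the set of scaled
  coordinates. With factors of product 1 the tensor stays the same, which is the source of normal
  forms.\<close>

lemma scale_coordinates:
  assumes x: "x \<in> tuples n E" and "finite S" "S \<subseteq> {1..n}"
  shows "(\<lambda>i. if i \<in> S then c i \<odot>\<^bsub>E i\<^esub> x i else x i) \<in> tuples n E \<and>
    basis_vec (\<lambda>i. if i \<in> S then c i \<odot>\<^bsub>E i\<^esub> x i else x i) - Poly_Mapping.single x (\<Prod>i\<in>S. c i) \<in> N"
  using assms(2,3)
proof (induction S rule: finite_induct)
  case empty then show ?case using x kernel_0 by simp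
next
  case (insert i S)
  define y where "y = (\<lambda>i. if i \<in> S then c i \<odot>\<^bsub>E i\<^esub> x i else x i)"
  have IH: "y \<in> tuples n E" "basis_vec y - Poly_Mapping.single x (\<Prod>i\<in>S. c i) \<in> N"
    using insert unfolding y_def by auto
  have i: "i \<in> {1..n}" using insert by simp
  have yi: "y i \<in> carrier (E i)" using IH(1) i by (rule PiE_mem)
  have eq: "(\<lambda>j. if j \<in> insert i S then c j \<odot>\<^bsub>E j\<^esub> x j else x j) = y(i := c i \<odot>\<^bsub>E i\<^esub> y i)"
    using insert by (auto simp: y_def)
  have "basis_vec (y(i := c i \<odot>\<^bsub>E i\<^esub> y i)) - Poly_Mapping.map ((*) (c i)) (basis_vec y) \<in> N"
    using kernel_scale[OF IH(1) i yi, of "c i"] by (simp only: fun_upd_triv)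
  moreover have "Poly_Mapping.map ((*) (c i)) (basis_vec y - Poly_Mapping.single x (\<Prod>i\<in>S. c i)) =
      Poly_Mapping.map ((*) (c i)) (basis_vec y) - Poly_Mapping.single x (\<Prod>i\<in>insert i S. c i)"
    using insert by (intro poly_mapping_eqI)
      (simp add: lookup_minus lookup_single when_def algebra_simps)
  then have "Poly_Mapping.map ((*) (c i)) (basis_vec y) - Poly_Mapping.single x (\<Prod>i\<in>insert i S. c i) \<in> N"
    using kernel_map_times[OF IH(2), of "c i"] by simp
  ultimately have "basis_vec (y(i := c i \<odot>\<^bsub>E i\<^esub> y i)) - Poly_Mapping.single x (\<Prod>i\<in>insert i S. c i) \<in> N"
    by (rule kernel_trans)
  moreover have "y(i := c i \<odot>\<^bsub>E i\<^esub> y i) \<in> tuples n E"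
    using IH(1) i normed.smult_in[OF normed[OF i] yi] by (rule tuples_upd)
  ultimately show ?case unfolding eq by blast
qed

text \<open>The scaling relator with scalar 0.\<close>

lemma basis_zero_coordinate:
  assumes x: "x \<in> tuples n E" and i: "i \<in> {1..n}" and "x i = \<zero>\<^bsub>E i\<^esub>"
  shows "basis_vec x \<in> N"
proof -
  interpret Ei: normed "E i" "nrm i" by (rule normed[OF i])
  have "0 \<odot>\<^bsub>E i\<^esub> x i = x i" using assms(3) by simp
  moreover have "x i \<in> carrier (E i)" using x i by (rule PiE_mem)
  ultimately show ?thesis
    using kernel_scale[OF x i, of "x i" 0] by simp
qed

lemma prod_nrm_0_iff:
  assumes "x \<in> tuples n E"
  shows "(\<Prod>i\<in>{1..n}. nrm i (x i)) = 0 \<longleftrightarrow> (\<exists>i\<in>{1..n}. x i = \<zero>\<^bsub>E i\<^esub>)"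
proof -
  have "nrm i (x i) = 0 \<longleftrightarrow> x i = \<zero>\<^bsub>E i\<^esub>" if "i \<in> {1..n}" for i
    by (rule normed.nrm_eq_0[OF normed[OF that] PiE_mem[OF assms that]])
  moreover have "(\<Prod>i\<in>{1..n}. nrm i (x i)) = 0 \<longleftrightarrow> (\<exists>i\<in>{1..n}. nrm i (x i) = 0)"
    by (rule prod_zero_iff) simp
  ultimately show ?thesis by blast
qed

section \<open>Tensor products of functionals as contractions\<close>

definition functionals :: "(nat \<Rightarrow> 'a \<Rightarrow> 'k) \<Rightarrow> bool" where
  "functionals \<phi> \<longleftrightarrow> (\<forall>i\<in>{1..n}. unit_functional (E i) (nrm i) (\<phi> i))"

lemma functionalsD:
  assumes "functionals \<phi>" "i \<in> {1..n}" "a \<in> carrier (E i)"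
  shows "b \<in> carrier (E i) \<Longrightarrow> \<phi> i (a \<oplus>\<^bsub>E i\<^esub> b) = \<phi> i a + \<phi> i b"
    and "\<phi> i (c \<odot>\<^bsub>E i\<^esub> a) = c * \<phi> i a" and "norm (\<phi> i a) \<le> nrm i a"
    and "b \<in> carrier (E i) \<Longrightarrow> \<phi> i (a \<ominus>\<^bsub>E i\<^esub> b) = \<phi> i a - \<phi> i b"
proof -
  interpret Ei: normed "E i" "nrm i" by (rule normed[OF assms(2)])
  show 1: "\<phi> i (a \<oplus>\<^bsub>E i\<^esub> b) = \<phi> i a + \<phi> i b" if "b \<in> carrier (E i)" for b
    using assms that by (auto simp: functionals_def unit_functional_def)
  show 2: "\<phi> i (c \<odot>\<^bsub>E i\<^esub> a) = c * \<phi> i a" and "norm (\<phi> i a) \<le> nrm i a"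
    using assms by (auto simp: functionals_def unit_functional_def)
  have "\<phi> i ((-1) \<odot>\<^bsub>E i\<^esub> b) = - \<phi> i b" if "b \<in> carrier (E i)" for b
  proof -
    have "\<phi> i ((-1) \<odot>\<^bsub>E i\<^esub> b) = (-1) * \<phi> i b"
      using assms that unfolding functionals_def unit_functional_def by blast
    then show ?thesis by simp
  qed
  then show "\<phi> i (a \<ominus>\<^bsub>E i\<^esub> b) = \<phi> i a - \<phi> i b" if "b \<in> carrier (E i)"
    using 1[of "\<ominus>\<^bsub>E i\<^esub> b"] that by (simp add: a_minus_def Ei.smult_neg_1)
qed

abbreviation tensor_functional :: "(nat \<Rightarrow> 'a \<Rightarrow> 'k) \<Rightarrow> (nat \<Rightarrow> 'a) \<Rightarrow> 'k" where
  "tensor_functional \<phi> x \<equiv> (\<Prod>i\<in>{1..n}. \<phi> i (x i))"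

lemma tensor_functional_le:
  assumes "functionals \<phi>" "x \<in> tuples n E"
  shows "norm (tensor_functional \<phi> x) \<le> (\<Prod>i\<in>{1..n}. nrm i (x i))"
  unfolding prod_norm[symmetric] using functionalsD(3)[OF assms(1)] assms(2)
  by (intro prod_mono) (auto dest: PiE_mem)

text \<open>This is what makes the tensor functional well defined on classes: multilinearity kills
  the relators, and the kernel is the smallest submodule that contains them.\<close>

lemma linear_extension_kernel:
  assumes \<phi>: "functionals \<phi>" and p: "p \<in> N"
  shows "linear_extension (tensor_functional \<phi>) p = 0"
proof -
  let ?L = "linear_extension (tensor_functional \<phi>)"
  let ?K = "{p. free_vec p \<and> ?L p = 0}"
  have sub: "submodule ?K (ring_of_type_algebra :: 'k ring) FS"
    unfolding submodule_free_space_iff free_vec_def[symmetric]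
    by (simp add: linear_extension_add linear_extension_map_times)
  have "multilinear_relators n E \<subseteq> ?K"
  proof
    fix r assume r: "r \<in> multilinear_relators n E"
    have upd: "tensor_functional \<phi> (x(i := a)) = \<phi> i a * (\<Prod>j\<in>{1..n} - {i}. \<phi> j (x j))"
      if "i \<in> {1..n}" for x i a
      using that by (intro prod_fun_upd) simp_all
    have "?L r = 0"
      using r unfolding multilinear_relators_def
    proof (elim UnE CollectE exE conjE)
      fix x i a b
      assume "r = basis_vec (x(i := a \<oplus>\<^bsub>E i\<^esub> b)) - basis_vec (x(i := a)) - basis_vec (x(i := b))"
        "i \<in> {1..n}" "a \<in> carrier (E i)" "b \<in> carrier (E i)"
      then show ?thesis
        by (simp only: linear_extension_diff linear_extension_single upd functionalsD(1)[OF \<phi>]) (simp add: algebra_simps)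
    next
      fix x i c a
      assume "r = basis_vec (x(i := c \<odot>\<^bsub>E i\<^esub> a)) - Poly_Mapping.map ((*) c) (basis_vec (x(i := a)))"
        "i \<in> {1..n}" "a \<in> carrier (E i)"
      then show ?thesis
        by (simp only: linear_extension_diff linear_extension_single linear_extension_map_times upd functionalsD(2)[OF \<phi>])
          (simp add: algebra_simps)
    qed
    then show "r \<in> ?K" using r relators_free by auto
  qed
  then have "N \<subseteq> ?K" by (intro multilinear_kernel_minimal sub)
  then show ?thesis using p by blast
qed

text \<open>A representation may replace \<open>p\<close> because the kernel contributes 0; then the
  triangle inequality applies termwise. Passing to the infimum gives contractivity for the
  projective norm.\<close>

lemma linear_extension_le_reps:
  assumes \<phi>: "functionals \<phi>" and s: "s \<in> reps p"
  shows "norm (linear_extension (tensor_functional \<phi>) p) \<le> s"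
proof -
  obtain m :: nat and x where x: "s = (\<Sum>j<m. \<Prod>i\<in>{1..n}. nrm i (x j i))" "\<forall>j<m. x j \<in> tuples n E"
    "p - (\<Sum>j<m. basis_vec (x j)) \<in> N" using s unfolding reps_def by blast
  have "linear_extension (tensor_functional \<phi>) p = (\<Sum>j<m. tensor_functional \<phi> (x j))"
    using linear_extension_kernel[OF \<phi> x(3)] by (simp add: linear_extension_diff linear_extension_sum)
  also have "norm \<dots> \<le> s"
    unfolding x(1) using x(2) tensor_functional_le[OF \<phi>] by (intro sum_norm_le) blast
  finally show ?thesis .
qed

lemma tensor_functional_diff_le:
  assumes "functionals \<phi>" "x \<in> tuples n E" "y \<in> tuples n E"
  shows "norm (tensor_functional \<phi> x - tensor_functional \<phi> y) \<le> tdist x y"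
proof -
  have "norm (tensor_functional \<phi> x - tensor_functional \<phi> y) \<le> s" if "s \<in> reps (basis_vec x - basis_vec y)" for s
    using linear_extension_le_reps[OF assms(1) that] by (simp add: linear_extension_diff)
  then show ?thesis
    using assms(2,3) unfolding tdist_eq[OF assms(2,3)] by (intro cInf_greatest reps_nonempty) simp_all
qed

end

section \<open>Normal forms and completeness\<close>

text \<open>The real and the complex case differ only in how norming functionals are obtained, so
  their existence is assumed here and the rest is shared.\<close>

locale normed_family_norming = normed_family n E nrm
  for n :: nat and E :: "nat \<Rightarrow> ('k::real_normed_field, 'a) module" and nrm :: "nat \<Rightarrow> 'a \<Rightarrow> real" +
  assumes norming: "\<And>i z. i \<in> {1..n} \<Longrightarrow> z \<in> carrier (E i) \<Longrightarrow>
    \<exists>\<phi>. unit_functional (E i) (nrm i) \<phi> \<and> norm (\<phi> z) = nrm i z"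
begin

lemma norming_functionals:
  assumes "x \<in> tuples n E"
  obtains \<phi> where "functionals \<phi>" "norm (tensor_functional \<phi> x) = (\<Prod>i\<in>{1..n}. nrm i (x i))"
proof -
  have "\<forall>i\<in>{1..n}. \<exists>\<phi>. unit_functional (E i) (nrm i) \<phi> \<and> norm (\<phi> (x i)) = nrm i (x i)"
    using norming PiE_mem[OF assms] by blast
  then obtain \<phi> where \<phi>: "\<forall>i\<in>{1..n}. unit_functional (E i) (nrm i) (\<phi> i) \<and> norm (\<phi> i (x i)) = nrm i (x i)"
    by (metis bchoice)
  show thesis
    by (rule that[of \<phi>]) (use \<phi> in \<open>auto simp: functionals_def prod_norm[symmetric] intro!: prod.cong\<close>)
qed

definition normal_form :: "(nat \<Rightarrow> 'a \<Rightarrow> 'k) \<Rightarrow> (nat \<Rightarrow> 'a) \<Rightarrow> bool" where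
  "normal_form \<phi> x \<longleftrightarrow> x \<in> tuples n E \<and> (\<forall>i\<in>{1..n} - {1}. \<phi> i (x i) = 1)"

text \<open>Coordinate 1 carries the whole value of the tensor, so a lower bound for tensor
  functionals becomes one for \<open>\<phi> 1 (x 1)\<close>.\<close>

lemma tensor_functional_normal_form:
  assumes "normal_form \<phi> x" shows "tensor_functional \<phi> x = \<phi> 1 (x 1)"
proof -
  have "tensor_functional \<phi> x = \<phi> 1 (x 1) * (\<Prod>i\<in>{1..n} - {1}. \<phi> i (x i))"
    using n_pos by (intro prod.remove) auto
  also have "(\<Prod>i\<in>{1..n} - {1}. \<phi> i (x i)) = 1"
    using assms by (intro prod.neutral) (simp add: normal_form_def)
  finally show ?thesis by simp
qed

lemma tensor_functional_cong:
  assumes "functionals \<phi>" "x \<in> tuples n E" "y \<in> tuples n E"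
    and "elementary_tensor n E x = elementary_tensor n E y"
  shows "tensor_functional \<phi> x = tensor_functional \<phi> y"
  using linear_extension_kernel[OF assms(1), of "basis_vec x - basis_vec y"] assms
  by (simp add: elementary_tensor_eq_iff linear_extension_diff)

lemma normal_form_exists:
  assumes \<phi>: "functionals \<phi>" and x: "x \<in> tuples n E" and nz: "tensor_functional \<phi> x \<noteq> 0"
  obtains y where "normal_form \<phi> y" "elementary_tensor n E y = elementary_tensor n E x"
    "\<phi> 1 (y 1) = tensor_functional \<phi> x"
proof -
  have 1: "1 \<in> {1..n}" using n_pos by simp
  have nz_i: "\<phi> i (x i) \<noteq> 0" if "i \<in> {1..n}" for i using nz that by auto
  \<comment> \<open>The factors for \<open>i \<noteq> 1\<close> normalise their coordinates, and
    \<open>c 1\<close> compensates for them, so that the total factor is 1.\<close>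
  define c where "c i = (if i = 1 then \<Prod>i\<in>{1..n} - {1}. \<phi> i (x i) else inverse (\<phi> i (x i)))" for i
  have "(\<Prod>i\<in>{1..n}. c i) = c 1 * (\<Prod>i\<in>{1..n} - {1}. c i)"
    using 1 by (intro prod.remove) auto
  also have "\<dots> = (\<Prod>i\<in>{1..n} - {1}. \<phi> i (x i) * inverse (\<phi> i (x i)))"
    unfolding prod.distrib by (simp add: c_def)
  also have "\<dots> = 1" using nz_i by (intro prod.neutral) simp
  finally have c: "(\<Prod>i\<in>{1..n}. c i) = 1" .
  define y where "y = (\<lambda>i. if i \<in> {1..n} then c i \<odot>\<^bsub>E i\<^esub> x i else x i)"
  have y: "y \<in> tuples n E" and "basis_vec y - basis_vec x \<in> N"
    using scale_coordinates[OF x finite_atLeastAtMost subset_refl, of c] unfolding y_def c by blast+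
  then have eq: "elementary_tensor n E y = elementary_tensor n E x"
    using x by (simp add: elementary_tensor_eq_iff)
  have "\<phi> i (y i) = 1" if "i \<in> {1..n} - {1}" for i
  proof -
    have i: "i \<in> {1..n}" using that by blast
    have "\<phi> i (y i) = c i * \<phi> i (x i)"
      using functionalsD(2)[OF \<phi> i PiE_mem[OF x i]] i unfolding y_def by simp
    then show ?thesis using that nz_i by (simp add: c_def)
  qed
  then have nf: "normal_form \<phi> y" using y by (simp add: normal_form_def)
  show thesis
    using that[OF nf eq] tensor_functional_normal_form[OF nf] tensor_functional_cong[OF \<phi> y x eq] by simp
qed

text \<open>
  Replacing \<open>\<phi> i\<close> by a functional \<open>\<psi>\<close> that norms \<open>x i \<ominus> y i\<close> recovers the \<open>i\<close>-th coordinate of a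
  normal form: the tensor functional then takes the value \<open>\<phi> 1 (x 1) * \<psi> (x i)\<close> at \<open>x\<close> for
  \<open>i \<noteq> 1\<close>, and \<open>\<psi> (x 1)\<close> for \<open>i = 1\<close>.
\<close>

lemma normal_form_dist:
  assumes \<phi>: "functionals \<phi>" and nx: "normal_form \<phi> x" and ny: "normal_form \<phi> y" and i: "i \<in> {1..n}"
    and \<delta>: "0 < \<delta>" "\<delta> \<le> norm (\<phi> 1 (x 1))"
  shows "nrm i (x i \<ominus>\<^bsub>E i\<^esub> y i) \<le> tdist x y * ((1 + nrm i (y i)) / \<delta> + 1)"
proof -
  interpret Ei: normed "E i" "nrm i" by (rule normed[OF i])
  have x: "x \<in> tuples n E" and y: "y \<in> tuples n E" using nx ny by (simp_all add: normal_form_def)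
  have xi: "x i \<in> carrier (E i)" using x i by (rule PiE_mem)
  have yi: "y i \<in> carrier (E i)" using y i by (rule PiE_mem)
  obtain \<psi> where \<psi>: "unit_functional (E i) (nrm i) \<psi>" "norm (\<psi> (x i \<ominus>\<^bsub>E i\<^esub> y i)) = nrm i (x i \<ominus>\<^bsub>E i\<^esub> y i)"
    using norming[OF i Ei.minus_closed[OF xi yi]] by blast
  define \<omega> where "\<omega> = \<phi>(i := \<psi>)"
  have \<omega>: "functionals \<omega>" using \<phi> \<psi>(1) by (simp add: functionals_def \<omega>_def)
  have \<omega>_prod: "tensor_functional \<omega> z = \<psi> (z i) * (\<Prod>j\<in>{1..n} - {i}. \<phi> j (z j))" for z
  proof -
    have "tensor_functional \<omega> z = \<omega> i (z i) * (\<Prod>j\<in>{1..n} - {i}. \<omega> j (z j))"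
      using i by (intro prod.remove) auto
    also have "(\<Prod>j\<in>{1..n} - {i}. \<omega> j (z j)) = (\<Prod>j\<in>{1..n} - {i}. \<phi> j (z j))"
      by (intro prod.cong) (auto simp: \<omega>_def)
    finally show ?thesis by (simp add: \<omega>_def)
  qed
  have \<psi>_diff: "\<psi> (x i \<ominus>\<^bsub>E i\<^esub> y i) = \<psi> (x i) - \<psi> (y i)" and \<psi>_le: "norm (\<psi> (y i)) \<le> nrm i (y i)"
    using functionalsD(3)[OF \<omega> i yi] functionalsD(4)[OF \<omega> i xi yi] by (simp_all add: \<omega>_def)
  let ?a = "\<phi> 1 (x 1)" and ?b = "\<phi> 1 (y 1)" and ?D = "tdist x y"
  have D: "0 \<le> ?D" by (rule tdist_nonneg)
  have yi_pos: "0 \<le> nrm i (y i)" using yi by (rule Ei.nrm_nonneg)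
  have \<omega>_le: "norm (tensor_functional \<omega> x - tensor_functional \<omega> y) \<le> ?D"
    by (rule tensor_functional_diff_le[OF \<omega> x y])
  \<comment> \<open>The two summands of the constant belong to the two cases: for
    \<open>i = 1\<close> the factor 1 is enough, and otherwise the division by
    \<open>\<phi> 1 (x 1)\<close> costs \<open>(1 + nrm i (y i)) / \<delta>\<close>.\<close>
  show ?thesis
  proof (cases "i = 1")
    case True
    have "tensor_functional \<omega> z = \<psi> (z i)" if "normal_form \<phi> z" for z
    proof -
      have "(\<Prod>j\<in>{1..n} - {i}. \<phi> j (z j)) = 1"
        using that True by (intro prod.neutral) (simp add: normal_form_def)
      then show ?thesis by (simp only: \<omega>_prod mult_1_right)
    qed
    then have "nrm i (x i \<ominus>\<^bsub>E i\<^esub> y i) \<le> ?D"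
      using \<omega>_le nx ny \<psi>(2) by (simp add: \<psi>_diff)
    also have "?D \<le> ?D * ((1 + nrm i (y i)) / \<delta> + 1)"
      using D \<delta>(1) yi_pos by (simp add: algebra_simps)
    finally show ?thesis .
  next
    case False
    have "tensor_functional \<omega> z = \<psi> (z i) * \<phi> 1 (z 1)" if "normal_form \<phi> z" for z
    proof -
      have "(\<Prod>j\<in>{1..n} - {i}. \<phi> j (z j)) = \<phi> 1 (z 1) * (\<Prod>j\<in>{1..n} - {i} - {1}. \<phi> j (z j))"
        using n_pos False by (intro prod.remove) auto
      also have "(\<Prod>j\<in>{1..n} - {i} - {1}. \<phi> j (z j)) = 1"
        using that by (intro prod.neutral) (simp add: normal_form_def)
      finally show ?thesis by (simp only: \<omega>_prod mult_1_right)
    qed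
    then have 1: "norm (\<psi> (x i) * ?a - \<psi> (y i) * ?b) \<le> ?D"
      using \<omega>_le nx ny by simp
    have 2: "norm (?b - ?a) \<le> ?D"
      using tensor_functional_diff_le[OF \<phi> x y]
      unfolding tensor_functional_normal_form[OF nx] tensor_functional_normal_form[OF ny]
      by (simp add: norm_minus_commute)
    \<comment> \<open>The leading scalars of \<open>x\<close> and \<open>y\<close> differ; adding
      and subtracting \<open>\<psi> (y i) * ?b\<close> leaves two differences of values of tensor
      functionals.\<close>
    have "?a * (\<psi> (x i) - \<psi> (y i)) = (\<psi> (x i) * ?a - \<psi> (y i) * ?b) + \<psi> (y i) * (?b - ?a)"
      by (simp add: algebra_simps)
    then have "norm ?a * nrm i (x i \<ominus>\<^bsub>E i\<^esub> y i) \<le> norm (\<psi> (x i) * ?a - \<psi> (y i) * ?b) + norm (\<psi> (y i)) * norm (?b - ?a)"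
      unfolding \<psi>(2)[symmetric] \<psi>_diff norm_mult[symmetric] by (simp add: norm_triangle_ineq)
    also have "\<dots> \<le> ?D + nrm i (y i) * ?D"
      using 1 2 \<psi>_le yi_pos by (intro add_mono mult_mono) simp_all
    finally have "norm ?a * nrm i (x i \<ominus>\<^bsub>E i\<^esub> y i) \<le> ?D * (1 + nrm i (y i))"
      by (simp add: algebra_simps)
    moreover have "\<delta> * nrm i (x i \<ominus>\<^bsub>E i\<^esub> y i) \<le> norm ?a * nrm i (x i \<ominus>\<^bsub>E i\<^esub> y i)"
      using \<delta>(2) xi yi by (intro mult_right_mono Ei.nrm_nonneg) simp_all
    ultimately have "nrm i (x i \<ominus>\<^bsub>E i\<^esub> y i) \<le> ?D * ((1 + nrm i (y i)) / \<delta>)"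
      using \<delta>(1) by (simp add: pos_le_divide_eq mult.commute)
    also have "\<dots> \<le> ?D * ((1 + nrm i (y i)) / \<delta> + 1)"
      using D by (intro mult_left_mono) simp_all
    finally show ?thesis .
  qed
qed

text \<open>Normal forms need a tensor functional that does not vanish. If some coordinate of
  \<open>x\<close> is zero, a functional norming \<open>y\<close> instead shows that
  \<open>y\<close> has a zero coordinate as well, and both tensors are zero. Otherwise a functional
  norming \<open>x\<close> takes the same nonzero value at \<open>y\<close>, and both have normal
  forms.\<close>

lemma tdist_eq_0D:
  assumes x: "x \<in> tuples n E" and y: "y \<in> tuples n E" and D0: "tdist x y = 0"
  shows "elementary_tensor n E x = elementary_tensor n E y"
proof (cases "(\<Prod>i\<in>{1..n}. nrm i (x i)) = 0")
  case True
  obtain \<phi> where \<phi>: "functionals \<phi>" "norm (tensor_functional \<phi> y) = (\<Prod>i\<in>{1..n}. nrm i (y i))"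
    using norming_functionals[OF y] .
  have "tensor_functional \<phi> x = 0"
    using tensor_functional_le[OF \<phi>(1) x] unfolding True by (simp only: norm_le_zero_iff)
  then have "norm (tensor_functional \<phi> y) \<le> 0"
    using tensor_functional_diff_le[OF \<phi>(1) x y] unfolding D0 by (simp only: diff_0 norm_minus_cancel)
  then have "(\<Prod>i\<in>{1..n}. nrm i (y i)) = 0"
    using \<phi>(2) norm_ge_zero[of "tensor_functional \<phi> y"] by linarith
  then have "basis_vec x \<in> N" "basis_vec y \<in> N"
    using True basis_zero_coordinate x y unfolding prod_nrm_0_iff[OF x] prod_nrm_0_iff[OF y] by blast+
  then show ?thesis using x y kernel_diff by (simp add: elementary_tensor_eq_iff)
next
  case False
  obtain \<phi> where \<phi>: "functionals \<phi>" "norm (tensor_functional \<phi> x) = (\<Prod>i\<in>{1..n}. nrm i (x i))"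
    using norming_functionals[OF x] .
  have nz: "tensor_functional \<phi> x \<noteq> 0" using False \<phi>(2) by (metis norm_zero)
  have "norm (tensor_functional \<phi> x - tensor_functional \<phi> y) \<le> 0"
    using tensor_functional_diff_le[OF \<phi>(1) x y] unfolding D0 .
  then have "tensor_functional \<phi> y = tensor_functional \<phi> x"
    by (simp only: norm_le_zero_iff right_minus_eq)
  then have nz': "tensor_functional \<phi> y \<noteq> 0" using nz by (simp only: not_False_eq_True)
  obtain x' where x': "normal_form \<phi> x'" "elementary_tensor n E x' = elementary_tensor n E x"
      "\<phi> 1 (x' 1) = tensor_functional \<phi> x"
    using normal_form_exists[OF \<phi>(1) x nz] .
  obtain y' where y': "normal_form \<phi> y'" "elementary_tensor n E y' = elementary_tensor n E y"
    using normal_form_exists[OF \<phi>(1) y nz'] .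
  have D0': "tdist x' y' = 0" using D0 x'(2) y'(2) by (simp add: tdist_def)
  have "x' i = y' i" if i: "i \<in> {1..n}" for i
  proof -
    interpret Ei: normed "E i" "nrm i" by (rule normed[OF i])
    have c: "x' i \<in> carrier (E i)" "y' i \<in> carrier (E i)"
      using x'(1) y'(1) i by (auto simp: normal_form_def dest: PiE_mem)
    have "nrm i (x' i \<ominus>\<^bsub>E i\<^esub> y' i) \<le> 0"
      \<comment> \<open>Any positive \<delta> would do, since it is multiplied by the distance
        0.\<close>
      using normal_form_dist[OF \<phi>(1) x'(1) y'(1) i, of "norm (\<phi> 1 (x' 1))"] D0' nz x'(3) by simp
    then have "nrm i (x' i \<ominus>\<^bsub>E i\<^esub> y' i) = 0"
      using Ei.nrm_nonneg[of "x' i \<ominus>\<^bsub>E i\<^esub> y' i"] c by simp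
    then show ?thesis using Ei.nrm_eq_0 Ei.diff_eq_zero_iff c by simp
  qed
  then have "x' = y'" using x'(1) y'(1) by (intro PiE_ext) (auto simp: normal_form_def)
  then show ?thesis using x'(2) y'(2) by simp
qed

section \<open>The metric on the Segre cone and its completeness\<close>

lemma Metric_space_segre_cone: "Metric_space (segre_cone n E) (projective_dist n E nrm)"
proof
  fix z w v
  show "0 \<le> projective_dist n E nrm z w" by (rule projective_dist_nonneg)
  show "projective_dist n E nrm z w = projective_dist n E nrm w z" by (rule projective_dist_commute)
  show "projective_dist n E nrm z w = 0 \<longleftrightarrow> z = w" if "z \<in> segre_cone n E" "w \<in> segre_cone n E"
    using that tdist_eq_0D tdist_self unfolding segre_cone_def tdist_def by auto
  show "projective_dist n E nrm z v \<le> projective_dist n E nrm z w + projective_dist n E nrm w v"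
    if "z \<in> segre_cone n E" "w \<in> segre_cone n E" "v \<in> segre_cone n E"
    using that tdist_triangle unfolding segre_cone_def tdist_def by auto
qed

text \<open>The coordinates are exchanged one at a time. Each exchange costs the distance in one
  coordinate, which tends to 0, times norms of the others, which converge.\<close>

lemma tdist_tendsto:
  assumes y: "\<And>k. y k \<in> tuples n E" and u: "u \<in> tuples n E"
    and lim: "\<And>i. i \<in> {1..n} \<Longrightarrow> (\<lambda>k::nat. nrm i (y k i \<ominus>\<^bsub>E i\<^esub> u i)) \<longlonglongrightarrow> 0"
  shows "(\<lambda>k. tdist (y k) u) \<longlonglongrightarrow> 0"
proof -
  \<comment> \<open>Hybrids: the first \<open>m\<close> coordinates already come from
    \<open>u\<close>, the others still from \<open>y k\<close>.\<close>
  define h where "h m k = (\<lambda>i. if i \<in> {1..m} then u i else y k i)" for m k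
  have h: "h m k \<in> tuples n E" for m k
    using y[of k] u by (auto simp: h_def PiE_iff extensional_def)
  have nrm_lim: "(\<lambda>k. nrm i (y k i)) \<longlonglongrightarrow> nrm i (u i)" if i: "i \<in> {1..n}" for i
  proof -
    interpret Ei: normed "E i" "nrm i" by (rule normed[OF i])
    have ui: "u i \<in> carrier (E i)" using u i by (rule PiE_mem)
    have yi: "y k i \<in> carrier (E i)" for k using y i by (rule PiE_mem)
    have "norm (nrm i (y k i) - nrm i (u i)) \<le> nrm i (y k i \<ominus>\<^bsub>E i\<^esub> u i)" for k
      using Ei.nrm_reverse_triangle[OF yi ui] by simp
    then have "(\<lambda>k. nrm i (y k i) - nrm i (u i)) \<longlonglongrightarrow> 0"
      by (intro Lim_null_comparison[OF _ lim[OF i]] always_eventually) blast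
    then show ?thesis by (rule LIM_zero_cancel)
  qed
  have "(\<lambda>k. tdist (y k) (h m k)) \<longlonglongrightarrow> 0" if "m \<le> n" for m
    using that
  proof (induction m)
    case 0
    have "h 0 k = y k" for k by (simp add: h_def)
    then show ?case using tdist_self[OF y] by simp
  next
    case (Suc m)
    let ?i = "Suc m"
    have i: "?i \<in> {1..n}" using Suc.prems by simp
    have h_Suc: "h ?i k = (h m k)(?i := u ?i)" for k by (auto simp: h_def)
    have hi: "h m k ?i = y k ?i" for k by (simp add: h_def)
    have ui: "u ?i \<in> carrier (E ?i)" using u i by (rule PiE_mem)
    have "(\<lambda>k. nrm j (h m k j)) \<longlonglongrightarrow> nrm j (u j)" if "j \<in> {1..n} - {?i}" for j
      using nrm_lim[of j] that by (cases "j \<in> {1..m}") (simp_all add: h_def)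
    then have "(\<lambda>k. tdist (y k) (h m k) +
        nrm ?i (y k ?i \<ominus>\<^bsub>E ?i\<^esub> u ?i) * (\<Prod>j\<in>{1..n} - {?i}. nrm j (h m k j)))
      \<longlonglongrightarrow> 0 + 0 * (\<Prod>j\<in>{1..n} - {?i}. nrm j (u j))"
      using Suc by (intro tendsto_add tendsto_mult tendsto_prod lim i) auto
    then have lim0: "(\<lambda>k. tdist (y k) (h m k) +
        nrm ?i (y k ?i \<ominus>\<^bsub>E ?i\<^esub> u ?i) * (\<Prod>j\<in>{1..n} - {?i}. nrm j (h m k j))) \<longlonglongrightarrow> 0"
      by simp
    have "norm (tdist (y k) (h ?i k)) \<le> tdist (y k) (h m k) +
        nrm ?i (y k ?i \<ominus>\<^bsub>E ?i\<^esub> u ?i) * (\<Prod>j\<in>{1..n} - {?i}. nrm j (h m k j))" for k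
      using tdist_triangle[OF y[of k] h[of m k] h[of ?i k]] tdist_upd[OF h i ui, of m k]
        tdist_nonneg[of "y k" "h ?i k"] unfolding h_Suc[symmetric] hi by simp
    then show ?case by (intro Lim_null_comparison[OF _ lim0] always_eventually) blast
  qed
  \<comment> \<open>Outside \<open>{1..n}\<close> both tuples have the default value of extensional
    functions.\<close>
  moreover have "h n k = u" for k
    using y[of k] u by (auto simp: h_def fun_eq_iff PiE_iff extensional_def)
  ultimately show ?thesis by fastforce
qed

text \<open>
  If the norms of the tensors do not tend to 0, then some tensor in the tail of the sequence has a norming
  functional \<open>\<Otimes>\<phi> i\<close> that stays away from 0 on the whole tail. The coordinates of the normal forms
  relative to \<open>\<phi>\<close> are then Cauchy sequences, and their limits yield the limit tensor.
\<close>

lemma elementary_tensors_complete: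
  assumes complete: "\<And>i. i \<in> {1..n} \<Longrightarrow> Metric_space.mcomplete (carrier (E i)) (induced_dist (E i) (nrm i))"
    and x: "\<And>k::nat. x k \<in> tuples n E"
    and cauchy: "\<And>\<epsilon>. 0 < \<epsilon> \<Longrightarrow> \<exists>M. \<forall>k\<ge>M. \<forall>l\<ge>M. tdist (x k) (x l) < \<epsilon>"
  obtains u where "u \<in> tuples n E" "(\<lambda>k. tdist (x k) u) \<longlonglongrightarrow> 0"
proof (cases "(\<lambda>k. \<Prod>i\<in>{1..n}. nrm i (x k i)) \<longlonglongrightarrow> 0")
  case True
  have 1: "1 \<in> {1..n}" using n_pos by simp
  interpret E1: normed "E 1" "nrm 1" by (rule normed[OF 1])
  \<comment> \<open>Every tuple with a zero coordinate represents the zero tensor;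
    \<open>x 0\<close> merely supplies the other coordinates.\<close>
  define u where "u = (x 0)(1 := \<zero>\<^bsub>E 1\<^esub>)"
  have u: "u \<in> tuples n E" unfolding u_def by (rule tuples_upd[OF x 1 E1.zero_closed])
  have "norm (tdist (x k) u) \<le> (\<Prod>i\<in>{1..n}. nrm i (x k i))" for k
  proof -
    \<comment> \<open>Another representative of the zero tensor, chosen to differ from
      \<open>x k\<close> in coordinate 1 only, so that the bound for one exchange is the full
      product of norms.\<close>
    define v where "v = (x k)(1 := \<zero>\<^bsub>E 1\<^esub>)"
    have v: "v \<in> tuples n E" unfolding v_def by (rule tuples_upd[OF x 1 E1.zero_closed])
    have "basis_vec u \<in> N" "basis_vec v \<in> N"
      using basis_zero_coordinate[OF u 1] basis_zero_coordinate[OF v 1] by (simp_all add: u_def v_def)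
    then have "elementary_tensor n E u = elementary_tensor n E v"
      using u v kernel_diff by (simp add: elementary_tensor_eq_iff)
    then have "tdist (x k) u = tdist (x k) v" by (simp add: tdist_def)
    also have "\<dots> \<le> nrm 1 (x k 1 \<ominus>\<^bsub>E 1\<^esub> \<zero>\<^bsub>E 1\<^esub>) * (\<Prod>j\<in>{1..n} - {1}. nrm j (x k j))"
      unfolding v_def by (rule tdist_upd[OF x 1 E1.zero_closed])
    also have "x k 1 \<ominus>\<^bsub>E 1\<^esub> \<zero>\<^bsub>E 1\<^esub> = x k 1"
      by (rule E1.diff_zero[OF PiE_mem[OF x 1]])
    also have "nrm 1 (x k 1) * (\<Prod>j\<in>{1..n} - {1}. nrm j (x k j)) = (\<Prod>i\<in>{1..n}. nrm i (x k i))"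
      using 1 by (intro prod.remove[symmetric]) auto
    finally show ?thesis using tdist_nonneg by simp
  qed
  then have "(\<lambda>k. tdist (x k) u) \<longlonglongrightarrow> 0"
    by (intro Lim_null_comparison[OF _ True] always_eventually) blast
  then show thesis by (rule that[OF u])
next
  case False
  have nn: "0 \<le> (\<Prod>i\<in>{1..n}. nrm i (x k i))" for k
    using x by (intro prod_nonneg nrm_nonneg) auto
  obtain \<epsilon> where \<epsilon>: "0 < \<epsilon>" "\<And>M. \<exists>k\<ge>M. \<epsilon> \<le> (\<Prod>i\<in>{1..n}. nrm i (x k i))"
    \<comment> \<open>This gives large norms infinitely often, not eventually; the lower bound on a
      whole tail has to come from a tensor functional.\<close>
    using False nn unfolding LIMSEQ_iff by (auto simp: not_less)
  obtain M where M: "\<And>k l. M \<le> k \<Longrightarrow> M \<le> l \<Longrightarrow> tdist (x k) (x l) < \<epsilon> / 2"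
    using cauchy[of "\<epsilon> / 2"] \<epsilon>(1) by auto
  obtain K where K: "M \<le> K" "\<epsilon> \<le> (\<Prod>i\<in>{1..n}. nrm i (x K i))" using \<epsilon>(2) by blast
  obtain \<phi> where \<phi>: "functionals \<phi>" "norm (tensor_functional \<phi> (x K)) = (\<Prod>i\<in>{1..n}. nrm i (x K i))"
    using norming_functionals[OF x] .
  \<comment> \<open>From \<open>M\<close> on, values of the tensor functional differ by at most
    \<open>\<epsilon> / 2\<close>, and at \<open>x K\<close> the value has norm at least
    \<epsilon>.\<close>
  define \<delta> where "\<delta> = \<epsilon> / 2"
  have \<delta>: "0 < \<delta>" using \<epsilon>(1) by (simp add: \<delta>_def)
  have lower: "\<delta> \<le> norm (tensor_functional \<phi> (x (k + M)))" for k
  proof -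
    have "norm (tensor_functional \<phi> (x K) - tensor_functional \<phi> (x (k + M))) \<le> \<epsilon> / 2"
      using tensor_functional_diff_le[OF \<phi>(1) x x, of K "k + M"] M[OF K(1), of "k + M"] by simp
    then show ?thesis
      using norm_triangle_ineq2[of "tensor_functional \<phi> (x K)" "tensor_functional \<phi> (x (k + M))"] K(2) \<phi>(2)
      by (simp add: \<delta>_def)
  qed
  have "\<exists>y. normal_form \<phi> y \<and> elementary_tensor n E y = elementary_tensor n E (x (k + M)) \<and>
      \<phi> 1 (y 1) = tensor_functional \<phi> (x (k + M))" for k
  proof -
    have nz: "tensor_functional \<phi> (x (k + M)) \<noteq> 0" using less_le_trans[OF \<delta> lower] by (simp only: zero_less_norm_iff not_False_eq_True)
    obtain z where "normal_form \<phi> z" "elementary_tensor n E z = elementary_tensor n E (x (k + M))"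
        "\<phi> 1 (z 1) = tensor_functional \<phi> (x (k + M))"
      using normal_form_exists[OF \<phi>(1) x nz] .
    then show ?thesis by (intro exI conjI)
  qed
  then obtain y where y: "\<And>k. normal_form \<phi> (y k)"
      "\<And>k. elementary_tensor n E (y k) = elementary_tensor n E (x (k + M))"
      "\<And>k. \<phi> 1 (y k 1) = tensor_functional \<phi> (x (k + M))"
    by metis
  have yt: "y k \<in> tuples n E" for k using y(1) by (simp add: normal_form_def)
  have yd: "tdist (y k) (y l) = tdist (x (k + M)) (x (l + M))" for k l by (simp add: tdist_def y(2))
  have "\<exists>a. a \<in> carrier (E i) \<and> (\<lambda>k. nrm i (y k i \<ominus>\<^bsub>E i\<^esub> a)) \<longlonglongrightarrow> 0" if i: "i \<in> {1..n}" for i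
  proof -
    interpret Ei: normed "E i" "nrm i" by (rule normed[OF i])
    interpret ME: Metric_space "carrier (E i)" "induced_dist (E i) (nrm i)"
      by (rule Ei.Metric_space_induced_dist)
    have yi: "y k i \<in> carrier (E i)" for k using yt i by (rule PiE_mem)
    have est: "nrm i (y k i \<ominus>\<^bsub>E i\<^esub> y l i) \<le> tdist (y k) (y l) * ((1 + nrm i (y l i)) / \<delta> + 1)" for k l
      using normal_form_dist[OF \<phi>(1) y(1) y(1) i \<delta>] lower y(3) by simp
    \<comment> \<open>The estimate for \<open>l = 0\<close>, with distances on the tail below
      \<open>\<epsilon> / 2\<close>, bounds the coordinate for all \<open>k\<close> at once.\<close>
    define B where "B = nrm i (y 0 i) + \<epsilon> / 2 * ((1 + nrm i (y 0 i)) / \<delta> + 1)"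
    have bound: "nrm i (y k i) \<le> B" for k
    proof -
      have "nrm i (y k i) \<le> nrm i (y k i \<ominus>\<^bsub>E i\<^esub> y 0 i) + nrm i (y 0 i)"
        using yi by (rule Ei.nrm_triangle) (rule yi)
      moreover have "tdist (y k) (y 0) * ((1 + nrm i (y 0 i)) / \<delta> + 1) \<le> \<epsilon> / 2 * ((1 + nrm i (y 0 i)) / \<delta> + 1)"
        using M[of "k + M" M] \<delta> Ei.nrm_nonneg[OF yi] by (intro mult_right_mono) (simp_all add: yd)
      ultimately show ?thesis using est[of k 0] unfolding B_def by linarith
    qed
    \<comment> \<open>The factor in the estimate depends on \<open>l\<close> through
      \<open>nrm i (y l i)\<close>; the bound \<open>B\<close> makes it uniform, as the Cauchy
      property requires.\<close>
    define C where "C = (1 + B) / \<delta> + 1"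
    have B: "0 \<le> B" using bound[of 0] Ei.nrm_nonneg[OF yi, of 0] by simp
    have C: "0 < C" using B \<delta> by (simp add: C_def add_nonneg_pos)
    have est_C: "nrm i (y k i \<ominus>\<^bsub>E i\<^esub> y l i) \<le> tdist (y k) (y l) * C" for k l
    proof -
      have "tdist (y k) (y l) * ((1 + nrm i (y l i)) / \<delta> + 1) \<le> tdist (y k) (y l) * C"
        using bound[of l] \<delta> by (intro mult_left_mono tdist_nonneg) (simp add: C_def divide_right_mono)
      then show ?thesis using est[of k l] by linarith
    qed
    have "ME.MCauchy (\<lambda>k. y k i)"
      unfolding ME.MCauchy_def
    proof (intro conjI allI impI)
      show "range (\<lambda>k. y k i) \<subseteq> carrier (E i)" using yi by blast
      fix r :: real assume "0 < r"
      then obtain M' where M': "\<And>k l. M' \<le> k \<Longrightarrow> M' \<le> l \<Longrightarrow> tdist (x k) (x l) < r / C"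
        using cauchy[of "r / C"] C by auto
      have "induced_dist (E i) (nrm i) (y k i) (y l i) < r" if "M' \<le> k" "M' \<le> l" for k l
      proof -
        have "tdist (y k) (y l) < r / C" unfolding yd using that by (intro M') simp_all
        then have "tdist (y k) (y l) * C < r" using C by (simp add: pos_less_divide_eq)
        then show ?thesis using est_C[of k l] yi by (simp add: induced_dist_def)
      qed
      then show "\<exists>M. \<forall>k l. M \<le> k \<longrightarrow> M \<le> l \<longrightarrow> induced_dist (E i) (nrm i) (y k i) (y l i) < r" by blast
    qed
    then obtain a where "limitin ME.mtopology (\<lambda>k. y k i) a sequentially"
      using complete[OF i] unfolding ME.mcomplete_def by blast
    then show ?thesis
      unfolding ME.limitin_metric_dist_null using yi by (auto simp: induced_dist_def)
  qed
  then obtain a where a: "\<And>i. i \<in> {1..n} \<Longrightarrow> a i \<in> carrier (E i) \<and> (\<lambda>k. nrm i (y k i \<ominus>\<^bsub>E i\<^esub> a i)) \<longlonglongrightarrow> 0"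
    by metis
  \<comment> \<open>Tuples are extensional, so the family of limits is cut down to
    \<open>{1..n}\<close>.\<close>
  define u where "u = restrict a {1..n}"
  have u: "u \<in> tuples n E" using a unfolding u_def by (simp add: restrict_PiE_iff)
  have "(\<lambda>k. tdist (y k) u) \<longlonglongrightarrow> 0"
    using a by (intro tdist_tendsto yt u) (simp add: u_def)
  then have "(\<lambda>k. tdist (x (k + M)) u) \<longlonglongrightarrow> 0" by (simp add: tdist_def y(2))
  then have "(\<lambda>k. tdist (x k) u) \<longlonglongrightarrow> 0" by (rule LIMSEQ_offset)
  then show thesis by (rule that[OF u])
qed

lemma mcomplete_segre_cone:
  assumes "\<And>i. i \<in> {1..n} \<Longrightarrow> Metric_space.mcomplete (carrier (E i)) (induced_dist (E i) (nrm i))"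
  shows "Metric_space.mcomplete (segre_cone n E) (projective_dist n E nrm)"
proof -
  interpret S: Metric_space "segre_cone n E" "projective_dist n E nrm" by (rule Metric_space_segre_cone)
  show ?thesis
    unfolding S.mcomplete_def
  proof (intro allI impI)
    fix \<sigma> assume \<sigma>: "S.MCauchy \<sigma>"
    then have "\<sigma> k \<in> segre_cone n E" for k unfolding S.MCauchy_def by blast
    then have "\<forall>k. \<exists>x. x \<in> tuples n E \<and> \<sigma> k = elementary_tensor n E x"
      unfolding segre_cone_def by blast
    then obtain x where x: "\<And>k. x k \<in> tuples n E" and \<sigma>x: "\<And>k. \<sigma> k = elementary_tensor n E (x k)"
      by metis
    have "\<exists>M. \<forall>k\<ge>M. \<forall>l\<ge>M. tdist (x k) (x l) < \<epsilon>" if "0 < \<epsilon>" for \<epsilon>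
    proof -
      have "\<exists>M. \<forall>k l. M \<le> k \<longrightarrow> M \<le> l \<longrightarrow> projective_dist n E nrm (\<sigma> k) (\<sigma> l) < \<epsilon>"
        by (rule mp[OF spec[OF conjunct2[OF \<sigma>[unfolded S.MCauchy_def]]] that])
      then show ?thesis by (simp add: tdist_def \<sigma>x)
    qed
    then obtain u where u: "u \<in> tuples n E" "(\<lambda>k. tdist (x k) u) \<longlonglongrightarrow> 0"
      by (rule elementary_tensors_complete[OF assms x, rotated]) blast+
    then have "limitin S.mtopology \<sigma> (elementary_tensor n E u) sequentially"
      using x unfolding S.limitin_metric_dist_null by (auto simp: \<sigma>x tdist_def segre_cone_def)
    then show "\<exists>z. limitin S.mtopology \<sigma> z sequentially" by blast
  qed
qed

end

section \<open>The real and the complex case\<close>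

lemma normed_family_normingI:
  fixes E :: "nat \<Rightarrow> ('k::real_normed_field, 'a) module"
  assumes "1 \<le> n" "\<forall>i\<in>{1..n}. banach_space (E i) (nrm i)"
    and "\<And>i z. normed_space (E i) (nrm i) \<Longrightarrow> z \<in> carrier (E i) \<Longrightarrow>
      \<exists>\<phi>. unit_functional (E i) (nrm i) \<phi> \<and> norm (\<phi> z) = nrm i z"
  shows "normed_family_norming n E nrm"
  using assms by unfold_locales (auto simp: banach_space_def)

lemma segre_cone_complete:
  fixes E :: "nat \<Rightarrow> ('k::real_normed_field, 'a) module"
  assumes "normed_family_norming n E nrm" "\<forall>i\<in>{1..n}. banach_space (E i) (nrm i)"
  shows "Metric_space (segre_cone n E) (projective_dist n E nrm) \<and>
    Metric_space.mcomplete (segre_cone n E) (projective_dist n E nrm)"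
proof -
  interpret normed_family_norming n E nrm by fact
  show ?thesis
    using Metric_space_segre_cone mcomplete_segre_cone assms(2) by (simp add: banach_space_def)
qed

theorem proposition2p12:
  fixes n :: nat
    and E :: "nat \<Rightarrow> (real, 'a) module" and nE :: "nat \<Rightarrow> 'a \<Rightarrow> real"
    and F :: "nat \<Rightarrow> (complex, 'b) module" and nF :: "nat \<Rightarrow> 'b \<Rightarrow> real"
  assumes "n \<ge> 1"
  shows "((\<forall>i\<in>{1..n}. banach_space (E i) (nE i)) \<longrightarrow>
            Metric_space (segre_cone n E) (projective_dist n E nE) \<and>
            Metric_space.mcomplete (segre_cone n E) (projective_dist n E nE)) \<and>
         ((\<forall>i\<in>{1..n}. banach_space (F i) (nF i)) \<longrightarrow>
            Metric_space (segre_cone n F) (projective_dist n F nF) \<and>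
            Metric_space.mcomplete (segre_cone n F) (projective_dist n F nF))"
proof (intro conjI impI)
  assume E: "\<forall>i\<in>{1..n}. banach_space (E i) (nE i)"
  have "\<exists>\<phi>. unit_functional (E i) (nE i) \<phi> \<and> norm (\<phi> z) = nE i z"
    if "normed_space (E i) (nE i)" "z \<in> carrier (E i)" for i z
  proof -
    interpret real_normed "E i" "nE i" using that by (intro real_normed.intro normed.intro)
    show ?thesis using norming_functional[OF that(2)] nrm_nonneg[OF that(2)] by (metis abs_of_nonneg real_norm_def)
  qed
  then have "normed_family_norming n E nE" using assms E by (intro normed_family_normingI)
  from segre_cone_complete[OF this E]
  show "Metric_space (segre_cone n E) (projective_dist n E nE)"
    "Metric_space.mcomplete (segre_cone n E) (projective_dist n E nE)" by blast+
next
  assume F: "\<forall>i\<in>{1..n}. banach_space (F i) (nF i)"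
  have "\<exists>\<phi>. unit_functional (F i) (nF i) \<phi> \<and> norm (\<phi> z) = nF i z"
    if Fi: "normed_space (F i) (nF i)" "z \<in> carrier (F i)" for i z
  proof -
    have "0 \<le> nF i z" using Fi by (simp add: normed_space_def)
    moreover obtain \<phi> where "unit_functional (F i) (nF i) \<phi>" "\<phi> z = nF i z"
      using complex_norming_functional[OF Fi] .
    ultimately show ?thesis by (intro exI[of _ \<phi>]) simp
  qed
  then have "normed_family_norming n F nF" using assms F by (intro normed_family_normingI)
  from segre_cone_complete[OF this F]
  show "Metric_space (segre_cone n F) (projective_dist n F nF)"
    "Metric_space.mcomplete (segre_cone n F) (projective_dist n F nF)" by blast+
qed

end
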